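(* Let $G:[0,+\infty)\times[0,+\infty)\to[0,+\infty)$, $G=G(z,v)$, be continuous in all its arguments, and assume that for every $v\in[0,+\infty)$ one has $G(0,v)=0$ and the mapping $z\mapsto \dfrac{G(z,v)}{z}$ is nondecreasing on $(0,+\infty)$. Then for every $u\in L$, $$\int_I G\bigl(|u'(x)|,u(x)\bigr)\,f(x)\,dx\ \ge\ \int_I G\bigl(|(u^* )'(x)|,u^*(x)\bigr)\,f(x)\,dx .$$
   Context: Let $\alpha\in(0,+\infty]$, $I=(0,\alpha)$, and let $\overline I$ be the closure of $I$ in $\mathbb R$ (so $\overline I=[0,+\infty)$ if $\alpha=+\infty$). The function $f$ satisfies: $f\in C(\overline I)$ and $f(x)>0$ for all $x\in I$; $f(x_2-x_1)\le f(x_1)+f(x_2)$ whenever $x_1,x_2\in\overline I$ with $x_1\le x_2$; and, if $\alpha<+\infty$, also $f(x)=f(\alpha-x)$ for all $x\in\overline I$. For a measurable set $M\subset I$ of finite Lebesgue measure $|M|$, put $M^*:=(0,|M|)$. Let $S$ be the class of Lebesgue measurable functions $u:I\to[0,+\infty)$ such that $|\{x\in I: u(x)>c\}|<+\infty$ for all $c>0$, and let $L$ be the set of functions $u\in S$ which are Lipschitz continuous and have compact support in $\overline I$. For $u\in S$ the decreasing rearrangement $u^*$ of $u$ is defined by $$u^*(x):=\sup\{c>0:\ x\in\{u(\cdot)>c\}^*\},\quad x\in I,$$ with $\sup\emptyset=0$. For $u\in L$ one has $u^*\in L$. *)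

theory Defs
  imports "HOL-Analysis.Analysis"
begin

definition ival :: "ereal \<Rightarrow> real set" where
  "ival \<alpha> = {x. 0 < x \<and> ereal x < \<alpha>}"

definition weight :: "ereal \<Rightarrow> (real \<Rightarrow> real) \<Rightarrow> bool" where
  "weight \<alpha> f \<longleftrightarrow>
     continuous_on (closure (ival \<alpha>)) f \<and>
     (\<forall>x\<in>ival \<alpha>. 0 < f x) \<and>
     (\<forall>x1\<in>closure (ival \<alpha>). \<forall>x2\<in>closure (ival \<alpha>).
        x1 \<le> x2 \<longrightarrow> f (x2 - x1) \<le> f x1 + f x2) \<and>
     (\<alpha> < \<infinity> \<longrightarrow> (\<forall>x\<in>closure (ival \<alpha>). f x = f (real_of_ereal \<alpha> - x)))"

text \<open>Functions on \<open>ival \<alpha>\<close> are represented by total functions on the reals; no notion below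
  depends on their values outside \<open>ival \<alpha>\<close>.\<close>

definition class_S :: "ereal \<Rightarrow> (real \<Rightarrow> real) set" where
  "class_S \<alpha> = {u. u \<in> borel_measurable (lebesgue_on (ival \<alpha>)) \<and>
     (\<forall>x\<in>ival \<alpha>. 0 \<le> u x) \<and>
     (\<forall>c>0. emeasure lebesgue {x\<in>ival \<alpha>. u x > c} < \<infinity>)}"

text \<open>The support is closed in the reals, hence a subset of \<open>closure (ival \<alpha>)\<close>: functions in
  this class need not vanish at the end points of the interval.\<close>

definition class_L :: "ereal \<Rightarrow> (real \<Rightarrow> real) set" where
  "class_L \<alpha> = {u \<in> class_S \<alpha>. (\<exists>C. C-lipschitz_on (ival \<alpha>) u) \<and>
     compact (closure (support_on (ival \<alpha>) u))}"

definition set_rearr :: "real set \<Rightarrow> real set" where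
  "set_rearr M = {0<..<measure lebesgue M}"

text \<open>The case distinction fixes the convention that the supremum of the empty set is 0, which
  \<^const>\<open>Sup\<close> on the reals does not provide.\<close>

definition decr_rearr :: "ereal \<Rightarrow> (real \<Rightarrow> real) \<Rightarrow> real \<Rightarrow> real" where
  "decr_rearr \<alpha> u x =
     (let C = {c. 0 < c \<and> x \<in> set_rearr {y\<in>ival \<alpha>. u y > c}}
      in if C = {} then 0 else Sup C)"

end

theory Submission
  imports Defs
begin

text \<open>Write \<open>G z v = z * g z v\<close> with \<open>g\<close> nondecreasing in \<open>z\<close>, and let \<open>w\<close> be the rearrangement of \<open>u\<close>. Both
integrals become integrals over the levels \<open>c\<close>. For the left-hand side, the coarea formula turns the
integral over the points with \<open>u' \<noteq> 0\<close> into the integral over \<open>c\<close> of the sum of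
\<open>g \<bar>u' p\<bar> c * f p\<close> over all \<open>p\<close> with \<open>u p = c\<close>. For the right-hand side, the only point of level
\<open>c\<close> at which \<open>w\<close> has a nonzero derivative is \<open>x = \<bar>{u > c}\<bar>\<close>, so an injective substitution gives
the integral of \<open>g \<bar>w' x\<bar> c * f x\<close>. It remains to compare the two integrands for almost every
\<open>c\<close>, which rests on two facts.

\<^item> Slopes: \<open>\<bar>w' x\<bar> \<le> \<bar>u' p\<bar>\<close> for every level point \<open>p\<close>. When \<open>c\<close> decreases, the superlevel set
  grows near \<open>p\<close> alone at rate at least \<open>1 / \<bar>u' p\<bar>\<close> (lemma \<open>rearr_slope_le\<close>). As \<open>g\<close> is
  nondecreasing, each \<open>g \<bar>u' p\<bar> c\<close> is at least \<open>g \<bar>w' x\<bar> c\<close>.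

\<^item> Perimeters: \<open>f x\<close> is at most the sum of \<open>f p\<close> over the level points. For almost every \<open>c\<close> there
  are finitely many of them, and the measure \<open>x\<close> of the superlevel set, or its complement
  \<open>\<alpha> - x\<close>, is an alternating sum of level points, to which the inequality for the weight applies
  repeatedly (lemmas \<open>alternating_sum_bound\<close> and \<open>perimeter_bound\<close>).

The analytic background is that Lipschitz functions of one variable are differentiable almost
everywhere and that their critical values form a null set. Both follow from one estimate for images of
sets, \<open>Vitali_image_bound\<close>, a consequence of the Vitali covering theorem.\<close>

section \<open>Images of small sets under Lipschitz functions\<close>

text \<open>If each point of \<open>E\<close> lies in arbitrarily short intervals whose length \<open>F\<close> multiplies by at most
\<open>r\<close>, then disjoint intervals of this kind inside \<open>Q\<close> cover \<open>E\<close> up to a null set, so the images have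
total length at most \<open>r\<close> times the measure of \<open>Q\<close>; the Lipschitz condition makes the image of the
exceptional null set negligible. Stating the bound for an open \<open>Q\<close> around \<open>E\<close> and some measurable
\<open>T\<close> around the image avoids every measurability question about \<open>E\<close>.\<close>
lemma Vitali_image_bound:
  fixes F :: "real \<Rightarrow> real"
  assumes lip: "K-lipschitz_on UNIV F" and "0 \<le> r"
    and "E \<subseteq> Q" "open Q" "Q \<in> lmeasurable"
    and small: "\<And>x d. x \<in> E \<Longrightarrow> 0 < d \<Longrightarrow>
      \<exists>p q p' q'. p < q \<and> x \<in> {p..q} \<and> q - p < d \<and> F ` {p..q} \<subseteq> {p'..q'} \<and> q' - p' \<le> r * (q - p)"
  obtains T where "F ` E \<subseteq> T" "T \<in> lmeasurable" "measure lebesgue T \<le> r * measure lebesgue Q"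
proof -
  let ?\<mu> = "measure lebesgue"
  \<comment> \<open>An interval \<open>{p..q}\<close> is encoded as a pair; as a closed ball it has the centre \<open>cen\<close> and the radius \<open>rad\<close>.\<close>
  define J where "J = {(p, q). p < q \<and> {p..q} \<subseteq> Q \<and>
    (\<exists>p' q'. F ` {p..q} \<subseteq> {p'..q'} \<and> q' - p' \<le> r * (q - p))}"
  define cen rad where "cen = (\<lambda>(p, q). (p + q) / 2 :: real)" and "rad = (\<lambda>(p, q). (q - p) / 2 :: real)"
  have ball: "cball (cen i) (rad i) = {fst i..snd i}" for i
    by (cases i) (auto simp: cen_def rad_def cball_eq_atLeastAtMost field_simps)
  have cover: "\<exists>i. i \<in> J \<and> x \<in> cball (cen i) (rad i) \<and> rad i < d" if x: "x \<in> E" and d: "0 < d" for x d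
  proof -
    obtain e where e: "0 < e" "ball x e \<subseteq> Q"
      using x assms(3,4) by (meson open_contains_ball subsetD)
    obtain p q p' q' where pq: "p < q" "x \<in> {p..q}" "q - p < min d e"
      "F ` {p..q} \<subseteq> {p'..q'}" "q' - p' \<le> r * (q - p)"
      using small[OF x, of "min d e"] d e by auto
    have "{p..q} \<subseteq> ball x e"
      using pq by (auto simp: dist_real_def)
    then have "(p, q) \<in> J"
      using pq e unfolding J_def by blast
    then show ?thesis
      using pq ball[of "(p, q)"] by (intro exI[of _ "(p, q)"]) (auto simp: rad_def simp del: mem_cball)
  qed
  have pos: "0 < rad i" if "i \<in> J" for i
    using that by (auto simp: J_def rad_def)
  obtain C where C: "countable C" "C \<subseteq> J"
    "pairwise (\<lambda>i j. disjnt (cball (cen i) (rad i)) (cball (cen j) (rad j))) C"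
    "negligible (E - (\<Union>i\<in>C. cball (cen i) (rad i)))"
    by (rule Vitali_covering_theorem_cballs[OF pos cover])
  have "\<forall>i\<in>J. \<exists>p' q'. F ` {fst i..snd i} \<subseteq> {p'..q'} \<and> q' - p' \<le> r * (snd i - fst i)"
    by (auto simp: J_def)
  then obtain lo hi where lh: "\<And>i. i \<in> J \<Longrightarrow> F ` {fst i..snd i} \<subseteq> {lo i..hi i}"
    "\<And>i. i \<in> J \<Longrightarrow> hi i - lo i \<le> r * (snd i - fst i)"
    by metis
  define N where "N = E - (\<Union>i\<in>C. cball (cen i) (rad i))"
  have fin: "?\<mu> (\<Union>i\<in>I. {lo i..hi i}) \<le> r * ?\<mu> Q" if I: "I \<subseteq> C" "finite I" for I
  proof -
    have "?\<mu> (\<Union>i\<in>I. {lo i..hi i}) \<le> (\<Sum>i\<in>I. ?\<mu> {lo i..hi i})"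
      using I by (intro measure_UNION_le) auto
    also have "\<dots> \<le> (\<Sum>i\<in>I. r * (snd i - fst i))"
    proof (rule sum_mono)
      fix i assume "i \<in> I"
      then have i: "i \<in> J" using I C by auto
      then have "lo i \<le> hi i"
        using lh(1)[OF i] by (fastforce simp: J_def)
      then show "?\<mu> {lo i..hi i} \<le> r * (snd i - fst i)"
        using lh(2)[OF i] by simp
    qed
    also have "\<dots> = r * (\<Sum>i\<in>I. ?\<mu> (cball (cen i) (rad i)))"
      unfolding sum_distrib_left
      using I C by (intro sum.cong) (auto simp: ball J_def)
    also have "(\<Sum>i\<in>I. ?\<mu> (cball (cen i) (rad i))) = ?\<mu> (\<Union>i\<in>I. cball (cen i) (rad i))"
      using I by (intro measure_UNION'[symmetric] pairwise_subset[OF C(3)]) auto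
    also have "\<dots> \<le> ?\<mu> Q"
    proof (rule measure_mono_fmeasurable)
      have "{fst i..snd i} \<subseteq> Q" if "i \<in> J" for i
        using that by (auto simp: J_def)
      then show "(\<Union>i\<in>I. cball (cen i) (rad i)) \<subseteq> Q"
        unfolding ball using I(1) C(2) by blast
    qed (use I assms(5) in \<open>auto intro!: sets.finite_UN\<close>)
    finally show ?thesis
      using \<open>0 \<le> r\<close> by (simp add: mult_left_mono)
  qed
  have T1: "(\<Union>i\<in>C. {lo i..hi i}) \<in> lmeasurable" "?\<mu> (\<Union>i\<in>C. {lo i..hi i}) \<le> r * ?\<mu> Q"
    by (intro fmeasurable_UN_bound[OF C(1) _ fin] measure_UN_bound[OF C(1) _ fin]; simp)+
  have "negligible (F ` N)"
  proof (rule negligible_locally_Lipschitz_image)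
    show "negligible N" using C(4) by (simp add: N_def)
    show "\<exists>T B. open T \<and> x \<in> T \<and> (\<forall>y\<in>N \<inter> T. norm (F y - F x) \<le> B * norm (y - x))" for x
      using lipschitz_onD[OF lip] by (intro exI[of _ UNIV] exI[of _ K]) (auto simp: dist_norm)
  qed simp
  then have "(\<Union>i\<in>C. {lo i..hi i}) \<union> F ` N \<in> lmeasurable"
    "?\<mu> ((\<Union>i\<in>C. {lo i..hi i}) \<union> F ` N) \<le> r * ?\<mu> Q"
    using T1 by (auto simp: negligible_imp_measurable measure_Un_null_set negligible_iff_null_sets
       intro!: fmeasurable.Un)
  moreover have "F ` E \<subseteq> (\<Union>i\<in>C. {lo i..hi i}) \<union> F ` N"
  proof
    fix y assume "y \<in> F ` E"
    then obtain x where x: "x \<in> E" "y = F x" by auto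
    show "y \<in> (\<Union>i\<in>C. {lo i..hi i}) \<union> F ` N"
    proof (cases "x \<in> N")
      case False
      then obtain i where i: "i \<in> C" "x \<in> {fst i..snd i}"
        using x by (auto simp: N_def ball)
      then have "F x \<in> {lo i..hi i}"
        using lh(1)[of i] C(2) by blast
      then show ?thesis using i x by blast
    qed (use x in auto)
  qed
  ultimately show thesis using that by blast
qed

lemma lipschitz_image_measure_bound:
  fixes F :: "real \<Rightarrow> real"
  assumes lip: "K-lipschitz_on UNIV F" and "open Q" "Q \<in> lmeasurable"
  obtains T where "F ` Q \<subseteq> T" "T \<in> lmeasurable" "measure lebesgue T \<le> K * measure lebesgue Q"
proof (rule Vitali_image_bound[OF lip _ subset_refl assms(2,3)])
  show K: "0 \<le> K" using lip lipschitz_on_nonneg by blast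
  fix x d :: real assume "0 < d"
  have "F ` {x - d/4..x + d/4} \<subseteq> {F x - K * (d/4)..F x + K * (d/4)}"
  proof clarify
    fix y assume "y \<in> {x - d/4..x + d/4}"
    then have "\<bar>y - x\<bar> \<le> d/4" unfolding abs_le_iff by auto
    then have "K * \<bar>y - x\<bar> \<le> K * (d/4)"
      using K by (intro mult_left_mono)
    then show "F y \<in> {F x - K * (d/4)..F x + K * (d/4)}"
      using lipschitz_onD[OF lip, of y x] by (auto simp: dist_real_def)
  qed
  then show "\<exists>p q p' q'. p < q \<and> x \<in> {p..q} \<and> q - p < d \<and> F ` {p..q} \<subseteq> {p'..q'} \<and> q' - p' \<le> K * (q - p)"
    using \<open>0 < d\<close>
    by (intro exI[of _ "x - d/4"] exI[of _ "x + d/4"] exI[of _ "F x - K * (d/4)"] exI[of _ "F x + K * (d/4)"])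
       (auto simp: field_simps)
qed blast

text \<open>The one-dimensional Sard theorem: near a point with zero derivative short intervals shrink by any
prescribed factor \<open>r\<close>.\<close>
lemma critical_values_negligible:
  fixes F :: "real \<Rightarrow> real"
  assumes lip: "K-lipschitz_on UNIV F" and "bounded E"
    and der: "\<And>x. x \<in> E \<Longrightarrow> (F has_field_derivative 0) (at x)"
  shows "negligible (F ` E)"
  unfolding negligible_outer_le
proof (intro allI impI)
  fix e :: real assume "0 < e"
  obtain B where B: "E \<subseteq> ball 0 B" "0 < B"
    using bounded_subset_ballD[OF \<open>bounded E\<close>, of 0] by blast
  let ?Q = "ball (0::real) B"
  have mQ: "measure lebesgue ?Q = 2 * B"
    using B by (simp add: ball_eq_greaterThanLessThan)
  \<comment> \<open>This \<open>r\<close> makes \<open>r\<close> times the length of \<open>ball 0 B\<close> equal to \<open>e\<close>.\<close>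
  define r where "r = e / (2 * B)"
  have "0 < r" using \<open>0 < e\<close> B by (simp add: r_def)
  have small: "\<exists>p q p' q'. p < q \<and> x \<in> {p..q} \<and> q - p < d \<and> F ` {p..q} \<subseteq> {p'..q'} \<and> q' - p' \<le> r * (q - p)"
    if "x \<in> E" "0 < d" for x d
  proof -
    have "(F has_derivative (\<lambda>h. 0)) (at x)"
      using der[OF that(1)] by (simp add: has_field_derivative_def mult_zero_left[abs_def])
    then obtain \<delta> where \<delta>: "0 < \<delta>" "\<And>y. norm (y - x) < \<delta> \<Longrightarrow> norm (F y - F x) \<le> r * norm (y - x)"
      using \<open>0 < r\<close> unfolding has_derivative_at_alt by (auto simp: has_derivative_at_alt)
    define t where "t = min \<delta> d / 4"
    have t: "0 < t" "t < \<delta>" "2 * t < d"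
      using \<delta> that(2) by (auto simp: t_def)
    have "F ` {x - t..x + t} \<subseteq> {F x - r * t..F x + r * t}"
    proof clarify
      fix y assume y: "y \<in> {x - t..x + t}"
      then have "r * \<bar>y - x\<bar> \<le> r * t"
        using \<open>0 < r\<close> by (intro mult_left_mono) auto
      moreover have "\<bar>F y - F x\<bar> \<le> r * \<bar>y - x\<bar>"
        using \<delta>(2)[of y] y t by auto
      ultimately show "F y \<in> {F x - r * t..F x + r * t}"
        by auto
    qed
    then show ?thesis using t
      by (intro exI[of _ "x - t"] exI[of _ "x + t"] exI[of _ "F x - r * t"] exI[of _ "F x + r * t"])
         (auto simp: field_simps)
  qed
  obtain T where "F ` E \<subseteq> T" "T \<in> lmeasurable" "measure lebesgue T \<le> r * measure lebesgue ?Q"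
    using Vitali_image_bound[OF lip less_imp_le[OF \<open>0 < r\<close>] B(1) open_ball lmeasurable_ball small] by blast
  moreover have "r * measure lebesgue ?Q = e"
    using B mQ by (simp add: r_def)
  ultimately show "\<exists>T. F ` E \<subseteq> T \<and> T \<in> lmeasurable \<and> measure lebesgue T \<le> e"
    by auto
qed

section \<open>Lipschitz functions are differentiable almost everywhere\<close>
lemma lmeasurable_open_superset:
  fixes T :: "'a::euclidean_space set"
  assumes T: "T \<in> lmeasurable" and "0 < e"
  obtains V where "open V" "T \<subseteq> V" "V \<in> lmeasurable" "measure lebesgue V < measure lebesgue T + e"
proof -
  obtain V where V: "open V" "T \<subseteq> V" "V - T \<in> lmeasurable" "emeasure lebesgue (V - T) < ennreal e"
    using sets_lebesgue_outer_open[OF fmeasurableD[OF T] \<open>0 < e\<close>] by metis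
  have eq: "V = T \<union> (V - T)" using V(2) by blast
  have "V \<in> lmeasurable" using T V(3) by (subst eq) (rule fmeasurable.Un)
  moreover have "measure lebesgue V \<le> measure lebesgue T + measure lebesgue (V - T)"
    using T V(3) by (subst eq) (intro measure_Un_le; auto)
  moreover have "measure lebesgue (V - T) < e"
    using V(3,4) \<open>0 < e\<close> by (simp add: emeasure_eq_measure2 ennreal_less_iff)
  ultimately show thesis using V that by force
qed

text \<open>If every open cover of \<open>E\<close> can be improved by the fixed factor \<open>\<theta> < 1\<close>, then the outer measure
\<open>I\<close> of \<open>E\<close>, being finite, satisfies \<open>I \<le> \<theta> * I\<close> and is \<open>0\<close>.\<close>
lemma negligible_if_cover_contracts:
  fixes E :: "'a::euclidean_space set"
  assumes "\<theta> < 1" "E \<subseteq> Q" "open Q" "Q \<in> lmeasurable"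
    and step: "\<And>Q. E \<subseteq> Q \<Longrightarrow> open Q \<Longrightarrow> Q \<in> lmeasurable \<Longrightarrow>
      \<exists>T. E \<subseteq> T \<and> T \<in> lmeasurable \<and> measure lebesgue T \<le> \<theta> * measure lebesgue Q"
  shows "negligible E"
proof -
  define M where "M = {measure lebesgue Q |Q. E \<subseteq> Q \<and> open Q \<and> Q \<in> lmeasurable}"
  define I where "I = Inf M"
  have bdd: "bdd_below M"
    unfolding M_def by (rule bdd_belowI[of _ 0]) auto
  have "M \<noteq> {}"
    unfolding M_def using assms(2-4) by blast
  have le: "I \<le> measure lebesgue T" if T: "E \<subseteq> T" "T \<in> lmeasurable" for T
  proof (rule field_le_epsilon)
    fix e :: real assume "0 < e"
    then obtain V where "open V" "T \<subseteq> V" "V \<in> lmeasurable" "measure lebesgue V < measure lebesgue T + e"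
      using lmeasurable_open_superset[OF T(2)] by metis
    moreover from this T have "I \<le> measure lebesgue V"
      unfolding I_def by (intro cInf_lower[OF _ bdd]) (unfold M_def, blast)
    ultimately show "I \<le> measure lebesgue T + e" by simp
  qed
  have ge: "\<exists>Q. E \<subseteq> Q \<and> open Q \<and> Q \<in> lmeasurable \<and> measure lebesgue Q < I + e" if "0 < e" for e
  proof -
    have "\<exists>v\<in>M. v < I + e"
      using that \<open>M \<noteq> {}\<close> by (intro cInf_lessD) (auto simp: I_def)
    then show ?thesis
      by (auto simp: M_def)
  qed
  have "0 \<le> I"
    unfolding I_def using \<open>M \<noteq> {}\<close> by (intro cInf_greatest) (auto simp: M_def)
  have "I \<le> 0"
  proof (rule ccontr)
    assume "\<not> I \<le> 0"
    \<comment> \<open>A cover of measure below \<open>(2 - \<theta>) * I\<close> is good enough, as \<open>\<theta> * (2 - \<theta>) = 1 - (1 - \<theta>)\<^sup>2 < 1\<close>.\<close>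
    then obtain Q where Q: "E \<subseteq> Q" "open Q" "Q \<in> lmeasurable" "measure lebesgue Q < I + (1 - \<theta>) * I"
      using ge[of "(1 - \<theta>) * I"] \<open>\<theta> < 1\<close> by auto
    then obtain T where T: "E \<subseteq> T" "T \<in> lmeasurable" "measure lebesgue T \<le> \<theta> * measure lebesgue Q"
      using step by blast
    show False
    proof (cases "\<theta> \<le> 0")
      case True
      then have "\<theta> * measure lebesgue Q \<le> 0"
        by (simp add: mult_nonpos_nonneg)
      then show False using le[OF T(1,2)] T(3) \<open>\<not> I \<le> 0\<close> by linarith
    next
      case False
      have "I \<le> \<theta> * measure lebesgue Q" using le[OF T(1,2)] T(3) by linarith
      also have "\<dots> < \<theta> * (I + (1 - \<theta>) * I)" using Q False by simp
      also have "\<dots> = I - (1 - \<theta>)\<^sup>2 * I" by (simp add: power2_eq_square algebra_simps)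
      also have "\<dots> \<le> I" using \<open>0 \<le> I\<close> by simp
      finally show False by simp
    qed
  qed
  then have "I = 0" using \<open>0 \<le> I\<close> by simp
  show ?thesis
    unfolding negligible_outer
  proof (intro allI impI)
    fix e :: real assume "0 < e"
    from ge[OF this] show "\<exists>T. E \<subseteq> T \<and> T \<in> lmeasurable \<and> measure lebesgue T < e"
      by (auto simp: \<open>I = 0\<close>)
  qed
qed

text \<open>Where \<open>F\<close> has difference quotients below \<open>r\<close> at arbitrarily small scales, it shrinks outer measure
by \<open>r\<close>; where it has quotients above \<open>s\<close>, its inverse \<open>H\<close> shrinks outer measure by \<open>1 / s\<close>. If both
happen throughout \<open>E\<close>, then \<open>E = H ` F ` E\<close> shrinks by \<open>r / s < 1\<close>. The expansion hypothesis is there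
to make \<open>H\<close> a 1-Lipschitz function on the whole line.\<close>
lemma Dini_gap_negligible:
  fixes F :: "real \<Rightarrow> real"
  assumes lip: "K-lipschitz_on UNIV F" and expand: "\<And>x y. x \<le> y \<Longrightarrow> y - x \<le> F y - F x"
    and "r < s" "bounded E"
    and low: "\<And>x d. x \<in> E \<Longrightarrow> 0 < d \<Longrightarrow> \<exists>p q. p < q \<and> x \<in> {p..q} \<and> q - p < d \<and> F q - F p \<le> r * (q - p)"
    and upp: "\<And>x d. x \<in> E \<Longrightarrow> 0 < d \<Longrightarrow> \<exists>p q. p < q \<and> x \<in> {p..q} \<and> q - p < d \<and> s * (q - p) \<le> F q - F p"
  shows "negligible E"
proof (cases "E = {}")
  case False
  then obtain x0 where "x0 \<in> E" by blast
  then obtain p0 q0 where "p0 < q0" "F q0 - F p0 \<le> r * (q0 - p0)"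
    using low[of x0 1] by auto
  moreover have "q0 - p0 \<le> F q0 - F p0"
    using \<open>p0 < q0\<close> by (intro expand) simp
  ultimately have "q0 - p0 \<le> r * (q0 - p0)" by linarith
  have r1: "1 \<le> r"
  proof (rule ccontr)
    assume "\<not> 1 \<le> r"
    then have "r * (q0 - p0) < 1 * (q0 - p0)"
      using \<open>p0 < q0\<close> by (intro mult_strict_right_mono) auto
    with \<open>q0 - p0 \<le> r * (q0 - p0)\<close> show False by simp
  qed
  from r1 have r0: "0 \<le> r" and s0: "0 \<le> 1 / s"
    using \<open>r < s\<close> by auto
  have mono: "F x \<le> F y" if "x \<le> y" for x y
    using expand[OF that] that by simp
  have smono: "F x \<le> F y \<longleftrightarrow> x \<le> y" for x y
    using expand[of x y] expand[of y x] by linarith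
  have "surj F"
  proof
    show "UNIV \<subseteq> range F"
    proof
      fix y :: real
      define R where "R = \<bar>y - F 0\<bar>"
      have "continuous_on {-R..R} F"
        by (rule lipschitz_on_continuous_on[OF lipschitz_on_subset[OF lip]]) simp
      moreover have "F (-R) \<le> y" "y \<le> F R"
        using expand[of "-R" 0] expand[of 0 R] by (auto simp: R_def)
      ultimately obtain x where "F x = y"
        using IVT'[of F "-R" y R] by (auto simp: R_def)
      then show "y \<in> range F" by blast
    qed
  qed auto
  define H where "H = inv F"
  have FH: "F (H y) = y" for y
    by (simp add: H_def surj_f_inv_f \<open>surj F\<close>)
  have HF: "H (F x) = x" for x
    using FH[of "F x"] smono by (metis antisym order_refl)
  have lipH: "1-lipschitz_on UNIV H"
  proof (rule lipschitz_onI)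
    fix x y :: real
    show "dist (H x) (H y) \<le> 1 * dist x y"
      using expand[of "H x" "H y"] expand[of "H y" "H x"]
      by (cases "H x \<le> H y") (auto simp: FH dist_real_def)
  qed simp
  have "0 < K"
  proof -
    have "1 \<le> F 1 - F 0" using expand[of 0 1] by simp
    also have "\<dots> \<le> K" using lipschitz_onD[OF lip, of 1 0] by (auto simp: dist_real_def)
    finally show ?thesis by simp
  qed
  have low': "\<exists>p q p' q'. p < q \<and> x \<in> {p..q} \<and> q - p < d \<and> F ` {p..q} \<subseteq> {p'..q'} \<and> q' - p' \<le> r * (q - p)"
    if xd: "x \<in> E" "0 < d" for x d
  proof -
    obtain p q where "p < q" "x \<in> {p..q}" "q - p < d" "F q - F p \<le> r * (q - p)"
      using low[OF xd] by blast
    then show ?thesis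
      by (intro exI[of _ p] exI[of _ q] exI[of _ "F p"] exI[of _ "F q"]) (auto simp: mono)
  qed
  have upp': "\<exists>p q p' q'. p < q \<and> y \<in> {p..q} \<and> q - p < d \<and> H ` {p..q} \<subseteq> {p'..q'} \<and> q' - p' \<le> 1 / s * (q - p)"
    if yd: "y \<in> F ` E" "0 < d" for y d
  proof -
    obtain x where x: "x \<in> E" "y = F x" using yd by blast
    obtain p q where pq: "p < q" "x \<in> {p..q}" "q - p < d / K" "s * (q - p) \<le> F q - F p"
      using upp[OF x(1), of "d / K"] yd \<open>0 < K\<close> by auto
    have "F q - F p \<le> K * (q - p)"
      using lipschitz_onD[OF lip, of q p] pq by (auto simp: dist_real_def)
    also have "\<dots> < d"
      using pq \<open>0 < K\<close> by (simp add: field_simps)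
    finally have "F q - F p < d" .
    moreover have "H ` {F p..F q} \<subseteq> {p..q}"
      using smono[of p "H _"] smono[of "H _" q] by (auto simp: FH)
    moreover have "q - p \<le> 1 / s * (F q - F p)"
      using pq \<open>1 \<le> r\<close> \<open>r < s\<close> by (simp add: field_simps)
    moreover have "F p < F q" "y \<in> {F p..F q}"
      using pq expand[of p q] x by (auto simp: mono)
    ultimately show ?thesis
      by (intro exI[of _ "F p"] exI[of _ "F q"] exI[of _ p] exI[of _ q]) simp
  qed
  obtain B where B: "E \<subseteq> ball 0 B"
    using bounded_subset_ballD[OF \<open>bounded E\<close>, of 0] by blast
  \<comment> \<open>A factor strictly between \<open>r / s\<close> and \<open>1\<close> leaves room to replace \<open>T\<close> by an open set \<open>V\<close> below.\<close>
  define \<theta> where "\<theta> = (r / s + 1) / 2"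
  have \<theta>: "r / s < \<theta>" "\<theta> < 1" "0 < r / s"
    using \<open>r < s\<close> \<open>1 \<le> r\<close> by (auto simp: \<theta>_def field_simps)
  show ?thesis
  proof (rule negligible_if_cover_contracts[OF \<theta>(2) B open_ball lmeasurable_ball])
    fix Q assume Q: "E \<subseteq> Q" "open Q" "Q \<in> lmeasurable"
    let ?m = "measure lebesgue Q"
    obtain T where T: "F ` E \<subseteq> T" "T \<in> lmeasurable" "measure lebesgue T \<le> r * ?m"
      by (rule Vitali_image_bound[OF lip r0 Q low'])
    show "\<exists>T. E \<subseteq> T \<and> T \<in> lmeasurable \<and> measure lebesgue T \<le> \<theta> * ?m"
    proof (cases "?m = 0")
      case True
      then show ?thesis using Q by (intro exI[of _ Q]) auto
    next
      case False
      then have "0 < (s * \<theta> - r) * ?m"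
        using \<theta> \<open>1 \<le> r\<close> \<open>r < s\<close> by (intro mult_pos_pos) (auto simp: zero_less_measure_iff field_simps)
      then obtain V where V: "open V" "T \<subseteq> V" "V \<in> lmeasurable"
        "measure lebesgue V < measure lebesgue T + (s * \<theta> - r) * ?m"
        using lmeasurable_open_superset[OF T(2)] by metis
      have "F ` E \<subseteq> V" using T V by blast
      then obtain T' where T': "H ` F ` E \<subseteq> T'" "T' \<in> lmeasurable" "measure lebesgue T' \<le> 1 / s * measure lebesgue V"
        by (rule Vitali_image_bound[OF lipH s0 _ V(1,3) upp'])
      have "measure lebesgue V \<le> s * \<theta> * ?m"
        using V(4) T(3) by (simp add: algebra_simps)
      then have "1 / s * measure lebesgue V \<le> \<theta> * ?m"
        using \<open>1 \<le> r\<close> \<open>r < s\<close> by (simp add: field_simps)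
      moreover have "H ` F ` E = E"
        by (force simp: HF image_image)
      ultimately show ?thesis using T' by (intro exI[of _ T']) auto
    qed
  qed
qed simp

text \<open>A bounded function converges along a filter unless its lower and upper limits differ, in which case
two rational numbers fit between them. Rational gaps suffice, so only countably many exceptional
sets arise when this is applied to difference quotients.\<close>
lemma convergent_filter_if_no_gap:
  fixes Q :: "'a \<Rightarrow> real"
  assumes "F \<noteq> bot" and bdd: "eventually (\<lambda>y. a \<le> Q y \<and> Q y \<le> b) F"
    and gap: "\<And>r s. r \<in> \<rat> \<Longrightarrow> s \<in> \<rat> \<Longrightarrow> r < s \<Longrightarrow> eventually (\<lambda>y. r \<le> Q y) F \<or> eventually (\<lambda>y. Q y \<le> s) F"
  shows "\<exists>L. (Q \<longlongrightarrow> L) F"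
proof -
  define X where "X = {r. eventually (\<lambda>y. r \<le> Q y) F}"
  have "a \<in> X" using bdd by (auto simp: X_def elim: eventually_mono)
  have ub: "r \<le> b" if "r \<in> X" for r
  proof -
    have "eventually (\<lambda>y. r \<le> b) F"
      using that bdd unfolding X_def mem_Collect_eq by eventually_elim auto
    then show ?thesis using \<open>F \<noteq> bot\<close> by (simp add: eventually_const_iff)
  qed
  then have bX: "bdd_above X" by (rule bdd_aboveI)
  define L where "L = Sup X"
  have "(Q \<longlongrightarrow> L) F"
  proof (rule tendstoI)
    fix e :: real assume "0 < e"
    obtain r where r: "r \<in> X" "L - e < r"
      using less_cSupD[of X "L - e"] \<open>a \<in> X\<close> \<open>0 < e\<close> by (force simp: L_def)
    obtain s where s: "s \<in> \<rat>" "L < s" "s < L + e"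
      using Rats_dense_in_real[of L "L + e"] \<open>0 < e\<close> by auto
    obtain t where t: "t \<in> \<rat>" "s < t" "t < L + e"
      using Rats_dense_in_real[of s "L + e"] s by auto
    have "s \<notin> X" using cSup_upper[OF _ bX] s by (force simp: L_def)
    then have "eventually (\<lambda>y. Q y \<le> t) F"
      using gap[OF s(1) t(1,2)] by (auto simp: X_def)
    moreover have "eventually (\<lambda>y. r \<le> Q y) F" using r by (simp add: X_def)
    ultimately show "eventually (\<lambda>y. dist (Q y) L < e) F"
      by eventually_elim (use r t in \<open>auto simp: dist_real_def\<close>)
  qed
  then show ?thesis by blast
qed

text \<open>Adding \<open>(C + 1) * x\<close> makes \<open>u\<close> an expanding bi-Lipschitz function \<open>F\<close> without changing where it is
differentiable. The points where \<open>F\<close> fails to be differentiable are covered by the sets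
\<open>E (n, r, s)\<close> with rational \<open>r < s\<close>, in which the quotients oscillate across the gap from \<open>r\<close> to \<open>s\<close>.\<close>
theorem lipschitz_differentiable_ae:
  fixes u :: "real \<Rightarrow> real"
  assumes lip: "C-lipschitz_on UNIV u"
  shows "negligible {x. \<not> u differentiable (at x)}"
proof -
  have "0 \<le> C" using lip lipschitz_on_nonneg by blast
  define F where "F = (\<lambda>x. u x + (C + 1) * x)"
  have abs: "\<bar>u y - u x\<bar> \<le> C * \<bar>y - x\<bar>" for x y
    using lipschitz_onD[OF lip, of y x] by (simp add: dist_real_def)
  have expand: "y - x \<le> F y - F x" if "x \<le> y" for x y
    using abs[of x y] that by (auto simp: F_def algebra_simps)
  have upper: "F y - F x \<le> (2 * C + 1) * (y - x)" if "x \<le> y" for x y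
    using abs[of x y] that by (auto simp: F_def algebra_simps)
  have lipF: "(2 * C + 1)-lipschitz_on UNIV F"
  proof (rule lipschitz_onI)
    fix x y :: real
    show "dist (F x) (F y) \<le> (2 * C + 1) * dist x y"
      using expand[of x y] expand[of y x] upper[of x y] upper[of y x]
      by (cases "x \<le> y") (auto simp: dist_real_def abs_if)
  qed (use \<open>0 \<le> C\<close> in auto)
  define Q where "Q = (\<lambda>x y. (F y - F x) / (y - x))"
  define E where "E = (\<lambda>(n::nat, r, s). {x. \<bar>x\<bar> \<le> real n \<and> r < s \<and>
    frequently (\<lambda>y. Q x y < r) (at x) \<and> frequently (\<lambda>y. s < Q x y) (at x)})"
  have interval: "\<exists>p q. p < q \<and> x \<in> {p..q} \<and> q - p < d \<and> P ((F q - F p) / (q - p))"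
    if fr: "frequently (\<lambda>y. P (Q x y)) (at x)" and "0 < d" for x d :: real and P
  proof -
    have "eventually (\<lambda>y. dist y x < d \<and> y \<noteq> x) (at x)"
      using \<open>0 < d\<close> by (auto simp: eventually_at)
    then have "frequently (\<lambda>y. P (Q x y) \<and> dist y x < d \<and> y \<noteq> x) (at x)"
      using fr by (rule frequently_eventually_conj[of _ _ "\<lambda>y. dist y x < d \<and> y \<noteq> x", rotated, unfolded conj_commute[of "dist _ _ < _ \<and> _"]])
    then obtain y where y: "P (Q x y)" "dist y x < d" "y \<noteq> x"
      by (auto dest: frequently_ex)
    show ?thesis
    proof (cases "x < y")
      case True
      then show ?thesis using y by (intro exI[of _ x] exI[of _ y]) (auto simp: Q_def dist_real_def)
    next
      case False
      moreover have "Q x y = (F x - F y) / (x - y)"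
        unfolding Q_def by (metis minus_diff_eq minus_divide_divide)
      ultimately show ?thesis using y by (intro exI[of _ y] exI[of _ x]) (auto simp: dist_real_def)
    qed
  qed
  have "negligible (E (n, r, s))" for n r s
  proof (cases "r < s")
    case True
    show ?thesis
    proof (rule Dini_gap_negligible[OF lipF expand True])
      show "bounded (E (n, r, s))"
        by (rule boundedI[of _ "real n"]) (auto simp: E_def)
    next
      fix x d :: real assume xd: "x \<in> E (n, r, s)" "0 < d"
      have "\<exists>p q. p < q \<and> x \<in> {p..q} \<and> q - p < d \<and> (F q - F p) / (q - p) < r"
        using xd by (intro interval) (auto simp: E_def)
      then show "\<exists>p q. p < q \<and> x \<in> {p..q} \<and> q - p < d \<and> F q - F p \<le> r * (q - p)"
        by (force simp: field_simps)
      have "\<exists>p q. p < q \<and> x \<in> {p..q} \<and> q - p < d \<and> s < (F q - F p) / (q - p)"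
        using xd by (intro interval) (auto simp: E_def)
      then show "\<exists>p q. p < q \<and> x \<in> {p..q} \<and> q - p < d \<and> s * (q - p) \<le> F q - F p"
        by (force simp: field_simps)
    qed
  qed (simp add: E_def)
  then have neg: "negligible (\<Union>i\<in>UNIV \<times> \<rat> \<times> \<rat>. E i)"
    by (intro negligible_countable_Union countable_image) (auto simp: countable_rat)
  have "u differentiable (at x)" if x: "x \<notin> (\<Union>i\<in>UNIV \<times> \<rat> \<times> \<rat>. E i)" for x
  proof -
    have "\<exists>L. (Q x \<longlongrightarrow> L) (at x)"
    proof (rule convergent_filter_if_no_gap)
      have "1 \<le> Q x y \<and> Q x y \<le> 2 * C + 1" if "y \<noteq> x" for y
      proof (cases "x < y")
        case True
        then show ?thesis using expand[of x y] upper[of x y] by (simp add: Q_def divide_simps)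
      next
        case False
        moreover have "Q x y = (F x - F y) / (x - y)"
          unfolding Q_def by (metis minus_diff_eq minus_divide_divide)
        ultimately show ?thesis
          using that expand[of y x] upper[of y x] by (simp add: le_divide_eq divide_le_eq)
      qed
      then show "eventually (\<lambda>y. 1 \<le> Q x y \<and> Q x y \<le> 2 * C + 1) (at x)"
        by (auto simp: eventually_at intro!: exI[of _ 1])
    next
      fix r s :: real assume rs: "r \<in> \<rat>" "s \<in> \<rat>" "r < s"
      obtain n :: nat where "\<bar>x\<bar> \<le> real n" using real_arch_simple by blast
      then have "\<not> (frequently (\<lambda>y. Q x y < r) (at x) \<and> frequently (\<lambda>y. s < Q x y) (at x))"
        using x rs by (auto simp: E_def)
      then show "eventually (\<lambda>y. r \<le> Q x y) (at x) \<or> eventually (\<lambda>y. Q x y \<le> s) (at x)"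
        by (auto simp: frequently_def not_less)
    qed simp
    then obtain L where "(F has_field_derivative L) (at x)"
      by (auto simp: Q_def has_field_derivative_iff)
    then have "((\<lambda>x. F x - (C + 1) * x) has_field_derivative L - (C + 1)) (at x)"
      by (auto intro!: derivative_eq_intros)
    then have "(u has_field_derivative L - (C + 1)) (at x)"
      by (simp add: F_def)
    then show ?thesis
      using real_differentiable_def by blast
  qed
  then have "{x. \<not> u differentiable (at x)} \<subseteq> (\<Union>i\<in>UNIV \<times> \<rat> \<times> \<rat>. E i)"
    by blast
  then show ?thesis by (rule negligible_subset[OF neg])
qed

section \<open>Extension of Lipschitz functions\<close>

text \<open>The McShane extension: the infimum of the largest \<open>C\<close>-Lipschitz functions through the points of the
graph of \<open>u\<close>. It allows the study of functions on an interval through functions on the line, with the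
same derivatives at interior points.\<close>
lemma lipschitz_extension:
  fixes u :: "real \<Rightarrow> real"
  assumes lip: "C-lipschitz_on S u" and "S \<noteq> {}"
  shows "\<exists>U. C-lipschitz_on UNIV U \<and> (\<forall>x\<in>S. U x = u x)"
proof -
  have "0 \<le> C" using lip lipschitz_on_nonneg by blast
  have uC: "u x \<le> u y + C * \<bar>x - y\<bar>" if "x \<in> S" "y \<in> S" for x y
    using lipschitz_onD[OF lip that] by (auto simp: dist_real_def)
  have tri: "C * \<bar>x - z\<bar> \<le> C * \<bar>x - y\<bar> + C * \<bar>y - z\<bar>" for x y z
    using mult_left_mono[OF abs_triangle_ineq[of "x - y" "y - z"] \<open>0 \<le> C\<close>] by (simp add: distrib_left)
  define U where "U x = (INF y\<in>S. u y + C * \<bar>x - y\<bar>)" for x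
  obtain y0 where "y0 \<in> S" using \<open>S \<noteq> {}\<close> by blast
  have bdd: "bdd_below ((\<lambda>y. u y + C * \<bar>x - y\<bar>) ` S)" for x
  proof (rule bdd_belowI2)
    fix y assume "y \<in> S"
    then show "u y0 - C * \<bar>y0 - x\<bar> \<le> u y + C * \<bar>x - y\<bar>"
      using uC[OF \<open>y0 \<in> S\<close>, of y] tri[of y0 y x] by linarith
  qed
  have shift: "U x \<le> U z + C * \<bar>x - z\<bar>" for x z
  proof -
    have "U x - C * \<bar>x - z\<bar> \<le> U z"
      unfolding U_def[of z]
    proof (rule cINF_greatest[OF \<open>S \<noteq> {}\<close>])
      fix y assume "y \<in> S"
      then have "U x \<le> u y + C * \<bar>x - y\<bar>"
        unfolding U_def by (rule cINF_lower[OF bdd])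
      then show "U x - C * \<bar>x - z\<bar> \<le> u y + C * \<bar>z - y\<bar>"
        using tri[of x y z] by linarith
    qed
    then show ?thesis by simp
  qed
  show ?thesis
  proof (intro exI[of _ U] conjI ballI)
    show "C-lipschitz_on UNIV U"
    proof (rule lipschitz_onI[OF _ \<open>0 \<le> C\<close>])
      show "dist (U x) (U y) \<le> C * dist x y" for x y
        using shift[of x y] shift[of y x] by (simp add: dist_real_def abs_le_iff abs_minus_commute)
    qed
    fix x assume x: "x \<in> S"
    show "U x = u x"
    proof (rule antisym)
      show "U x \<le> u x"
        unfolding U_def using cINF_lower[OF bdd x, of x] by simp
      show "u x \<le> U x"
        unfolding U_def using x by (intro cINF_greatest[OF \<open>S \<noteq> {}\<close>] uC)
    qed
  qed
qed

section \<open>Weights and unions of intervals\<close>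

text \<open>Let membership in \<open>A\<close> change only at points of \<open>P\<close>, and let \<open>A\<close> contain no point of the last gap. Then
\<open>A \<inter> {0<..<T}\<close> has the measure \<open>y\<^sub>k - y\<^sub>k\<^sub>-\<^sub>1 + y\<^sub>k\<^sub>-\<^sub>2 - \<dots>\<close> for some of the points of \<open>P\<close>, and the
inequality \<open>f (y - x) \<le> f x + f y\<close> strips off one point at a time. The induction removes the last
point \<open>b\<close>; if the gap before \<open>b\<close> belongs to \<open>A\<close>, it is the complement of \<open>A\<close> in \<open>{0<..<b}\<close> that meets
the hypotheses, and \<open>A\<close> has measure \<open>b\<close> minus that of the complement. Measure \<open>0\<close> is a separate
alternative because \<open>f 0\<close> is bounded only by \<open>2 * f y\<close>.\<close>
lemma alternating_sum_bound:
  fixes f :: "real \<Rightarrow> real"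
  assumes "finite P"
    and sub: "\<And>x y. 0 \<le> x \<Longrightarrow> x \<le> y \<Longrightarrow> y \<in> J \<Longrightarrow> f (y - x) \<le> f x + f y"
    and nonneg: "\<And>x. x \<in> J \<Longrightarrow> 0 \<le> f x"
  shows "A \<in> sets lebesgue \<Longrightarrow> P \<subseteq> J \<Longrightarrow> P \<subseteq> {0<..<T} \<Longrightarrow>
    (\<And>x y. 0 < x \<Longrightarrow> x \<le> y \<Longrightarrow> y < T \<Longrightarrow> {x..y} \<inter> P = {} \<Longrightarrow> x \<in> A \<longleftrightarrow> y \<in> A) \<Longrightarrow>
    (\<And>x. 0 < x \<Longrightarrow> x < T \<Longrightarrow> \<forall>p\<in>P. p < x \<Longrightarrow> x \<notin> A) \<Longrightarrow>
    measure lebesgue (A \<inter> {0<..<T}) = 0 \<or> f (measure lebesgue (A \<inter> {0<..<T})) \<le> sum f P"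
  using \<open>finite P\<close>
proof (induction P arbitrary: A T rule: finite_linorder_max_induct)
  case empty
  then have "A \<inter> {0<..<T} = {}" by auto
  then show ?case by simp
next
  case (insert b P)
  note const = insert.prems(4) and top = insert.prems(5)
  have b: "0 < b" "b < T" "b \<in> J" and PJ: "P \<subseteq> J" "P \<subseteq> {0<..<b}"
    using insert.prems insert.hyps by auto
  have "b \<notin> P" using insert.hyps by auto
  then have sum: "sum f (insert b P) = f b + sum f P" "0 \<le> sum f P" "0 \<le> f b"
    using insert.hyps(1) nonneg b PJ by (auto intro!: sum_nonneg)
  have constb: "x \<in> A \<longleftrightarrow> y \<in> A" if "0 < x" "x \<le> y" "y < b" "{x..y} \<inter> P = {}" for x y
    using that b by (intro const) auto
  have lm: "B \<inter> {0<..<S} \<in> lmeasurable" if "B \<in> sets lebesgue" for B and S :: real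
    using that by (intro fmeasurable_Int_fmeasurable[of "{0<..<S}", simplified Int_commute[of "{0<..<S}"]]) auto
  have cut: "measure lebesgue (A \<inter> {0<..<T}) = measure lebesgue (A \<inter> {0<..<b})"
  proof (rule measure_negligible_symdiff[OF lm])
    have above: "x \<notin> A" if "b < x" "x < T" for x
      using that b insert.hyps by (intro top) auto
    have "x < b" if "x \<in> A" "x < T" "x \<noteq> b" for x
      using above[of x] that by linarith
    then have "(A \<inter> {0<..<b} - A \<inter> {0<..<T}) \<union> (A \<inter> {0<..<T} - A \<inter> {0<..<b}) \<subseteq> {b}"
      using b by auto
    then show "negligible ((A \<inter> {0<..<b} - A \<inter> {0<..<T}) \<union> (A \<inter> {0<..<T} - A \<inter> {0<..<b}))"
      by (rule negligible_subset[rotated]) simp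
  qed (rule insert.prems)
  show ?case
  proof (cases "\<forall>x. 0 < x \<and> x < b \<and> (\<forall>p\<in>P. p < x) \<longrightarrow> x \<notin> A")
    case True
    have "measure lebesgue (A \<inter> {0<..<b}) = 0 \<or> f (measure lebesgue (A \<inter> {0<..<b})) \<le> sum f P"
      using insert.IH[of A b] True constb PJ insert.prems(1) by simp
    then show ?thesis using sum cut by auto
  next
    case False
    then obtain z where z: "0 < z" "z < b" "\<forall>p\<in>P. p < z" "z \<in> A" by auto
    have topc: "x \<notin> - A" if "0 < x" "x < b" "\<forall>p\<in>P. p < x" for x
    proof (cases "x \<le> z")
      case True
      then have "{x..z} \<inter> P = {}" using that by force
      then show ?thesis using constb[of x z] True that z by auto
    next
      case False
      then have "{z..x} \<inter> P = {}" using z by force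
      then show ?thesis using constb[of z x] False that z by auto
    qed
    let ?s = "measure lebesgue (- A \<inter> {0<..<b})"
    have cA: "- A \<in> sets lebesgue" using insert.prems(1) by (simp add: Compl_in_sets_lebesgue)
    have IH: "?s = 0 \<or> f ?s \<le> sum f P"
      using insert.IH[of "- A" b] topc constb PJ cA by simp
    have "measure lebesgue ((A \<inter> {0<..<b}) \<union> (- A \<inter> {0<..<b})) = measure lebesgue (A \<inter> {0<..<b}) + ?s"
      using lm[OF insert.prems(1)] lm[OF cA] by (intro measure_Un3[THEN trans]) auto
    moreover have "(A \<inter> {0<..<b}) \<union> (- A \<inter> {0<..<b}) = {0<..<b}" by blast
    ultimately have "measure lebesgue (A \<inter> {0<..<b}) = b - ?s"
      using b by simp
    moreover from this have "?s \<le> b"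
      by (metis diff_ge_0_iff_ge measure_nonneg)
    moreover from \<open>?s \<le> b\<close> have "f (b - ?s) \<le> f b + sum f P"
    proof (cases "?s = 0")
      case False
      then show ?thesis using IH sub[of ?s b] b \<open>?s \<le> b\<close> by fastforce
    qed (use sum in auto)
    ultimately show ?thesis using sum cut by simp
  qed
qed

section \<open>The decreasing rearrangement of a Lipschitz function\<close>
lemma has_field_derivative_zero_if_locally_constant_left:
  fixes w :: "real \<Rightarrow> real"
  assumes "(w has_field_derivative d) (at x)" "a < x" "\<And>y. a < y \<Longrightarrow> y < x \<Longrightarrow> w y = w x"
  shows "d = 0"
proof -
  have "((\<lambda>y. (w y - w x) / (y - x)) \<longlongrightarrow> d) (at_left x)"
    using assms(1) unfolding has_field_derivative_iff by (rule tendsto_mono[rotated]) (simp add: at_le)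
  moreover have "((\<lambda>y. (w y - w x) / (y - x)) \<longlongrightarrow> 0) (at_left x)"
    by (rule tendsto_eventually, rule eventually_at_leftI[OF _ assms(2)]) (simp add: assms(3))
  ultimately show ?thesis by (rule tendsto_unique[rotated]) simp
qed

lemma has_field_derivative_zero_if_locally_constant_right:
  fixes w :: "real \<Rightarrow> real"
  assumes "(w has_field_derivative d) (at x)" "x < b" "\<And>y. x < y \<Longrightarrow> y < b \<Longrightarrow> w y = w x"
  shows "d = 0"
proof -
  have "((\<lambda>y. (w y - w x) / (y - x)) \<longlongrightarrow> d) (at_right x)"
    using assms(1) unfolding has_field_derivative_iff by (rule tendsto_mono[rotated]) (simp add: at_le)
  moreover have "((\<lambda>y. (w y - w x) / (y - x)) \<longlongrightarrow> 0) (at_right x)"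
    by (rule tendsto_eventually, rule eventually_at_rightI[OF _ assms(2)]) (simp add: assms(3))
  ultimately show ?thesis by (rule tendsto_unique[rotated]) simp
qed

text \<open>The setting for the function to be rearranged: it is Lipschitz on the whole line, but nonnegative and
of bounded support only within the interval, which is how an extended member of the class \<open>L\<close> looks.\<close>
locale profile =
  fixes \<alpha> :: ereal and u :: "real \<Rightarrow> real" and C R :: real
  assumes lip: "C-lipschitz_on UNIV u"
    and nonneg: "\<And>x. x \<in> ival \<alpha> \<Longrightarrow> 0 \<le> u x"
    and supp: "\<And>x. x \<in> ival \<alpha> \<Longrightarrow> R \<le> x \<Longrightarrow> u x = 0"
    and R_pos: "0 < R"
begin

definition superlevel :: "real \<Rightarrow> real set" where
  "superlevel c = {x \<in> ival \<alpha>. c < u x}"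

definition distribution :: "real \<Rightarrow> real" where
  "distribution c = measure lebesgue (superlevel c)"

definition rearr :: "real \<Rightarrow> real" where
  "rearr = decr_rearr \<alpha> u"

lemma C_nonneg: "0 \<le> C"
  using lip lipschitz_on_nonneg by blast

lemma u_abs: "\<bar>u x - u y\<bar> \<le> C * \<bar>x - y\<bar>"
  using lipschitz_onD[OF lip, of x y] by (simp add: dist_real_def)

lemma cont: "continuous_on S u"
  using lipschitz_on_continuous_on[OF lip] continuous_on_subset by blast

lemma open_ival: "open (ival \<alpha>)"
proof (cases \<alpha>)
  case (real r)
  then have "ival \<alpha> = {0<..<r}" by (auto simp: ival_def)
  then show ?thesis by simp
next
  case PInf
  then have "ival \<alpha> = {0<..}" by (auto simp: ival_def)
  then show ?thesis by simp
next
  case MInf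
  then have "ival \<alpha> = {}" by (auto simp: ival_def)
  then show ?thesis by simp
qed

lemma ival_pos: "x \<in> ival \<alpha> \<Longrightarrow> 0 < x"
  by (simp add: ival_def)

lemma ival_mono: "y \<in> ival \<alpha> \<Longrightarrow> 0 < x \<Longrightarrow> x \<le> y \<Longrightarrow> x \<in> ival \<alpha>"
  by (auto simp: ival_def) (metis ereal_less_eq(3) order_le_less_trans)

lemma open_superlevel: "open {x \<in> ival \<alpha>. c < u x}"
proof -
  have "open (u -` {c<..})" using cont[of UNIV] by (intro open_vimage) auto
  then have "open (ival \<alpha> \<inter> u -` {c<..})" by (rule open_Int[OF open_ival])
  also have "ival \<alpha> \<inter> u -` {c<..} = {x \<in> ival \<alpha>. c < u x}" by auto
  finally show ?thesis .
qed

lemma superlevel_subset: "0 \<le> c \<Longrightarrow> superlevel c \<subseteq> {0<..<R}"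
  using supp ival_pos by (force simp: superlevel_def not_less[symmetric])

lemma superlevel_lmeasurable: "0 \<le> c \<Longrightarrow> superlevel c \<in> lmeasurable"
  using open_superlevel[of c] superlevel_subset[of c] bounded_subset[of "{0<..<R}"]
  by (intro lmeasurable_open) (auto simp: superlevel_def)

lemma distribution_antimono: "0 \<le> c \<Longrightarrow> c \<le> d \<Longrightarrow> distribution d \<le> distribution c"
  unfolding distribution_def
  using superlevel_lmeasurable[of c] superlevel_lmeasurable[of d]
  by (intro measure_mono_fmeasurable) (auto simp: superlevel_def)

lemma mem_superlevel_bound: "0 \<le> c \<Longrightarrow> x \<in> superlevel c \<Longrightarrow> c \<le> u 0 + C * R"
proof -
  assume "0 \<le> c" "x \<in> superlevel c"
  then have x: "0 < x" "x < R" "c < u x" using superlevel_subset[of c] by (auto simp: superlevel_def)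
  have "C * \<bar>x - 0\<bar> \<le> C * R" using C_nonneg x by (intro mult_left_mono) auto
  then show ?thesis using u_abs[of x 0] x by auto
qed

lemma rearr_eq: "rearr x = (let L = {c. 0 < c \<and> 0 < x \<and> x < distribution c} in if L = {} then 0 else Sup L)"
  by (simp add: rearr_def decr_rearr_def set_rearr_def distribution_def superlevel_def)

text \<open>This and \<open>less_distribution\<close> say that the rearrangement and the distribution function are generalized
inverses of each other; all further properties of the rearrangement come from these two.\<close>
lemma le_rearr:
  assumes "0 < c" "0 < x" "x < distribution c"
  shows "c \<le> rearr x"
proof -
  have "bdd_above {c. 0 < c \<and> 0 < x \<and> x < distribution c}"
  proof (rule bdd_aboveI)
    fix d assume d: "d \<in> {c. 0 < c \<and> 0 < x \<and> x < distribution c}"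
    then have "superlevel d \<noteq> {}" by (auto simp: distribution_def)
    then show "d \<le> u 0 + C * R" using mem_superlevel_bound[of d] d by auto
  qed
  then have "c \<le> Sup {c. 0 < c \<and> 0 < x \<and> x < distribution c}"
    using assms by (intro cSup_upper) auto
  then show ?thesis using assms by (auto simp: rearr_eq Let_def)
qed

lemma less_distribution:
  assumes "0 \<le> c" "c < rearr x"
  shows "x < distribution c"
proof (cases "{c. 0 < c \<and> 0 < x \<and> x < distribution c} = {}")
  case True
  then show ?thesis using assms by (simp add: rearr_eq Let_def)
next
  case False
  then have "c < Sup {c. 0 < c \<and> 0 < x \<and> x < distribution c}"
    using assms(2) unfolding rearr_eq Let_def by (simp only: if_False)
  from less_cSupD[OF False this] obtain d where "c < d" "x < distribution d" by auto
  then show ?thesis using distribution_antimono[OF assms(1), of d] by simp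
qed

lemma rearr_nonneg: "0 \<le> rearr x"
proof (cases "{c. 0 < c \<and> 0 < x \<and> x < distribution c} = {}")
  case False
  then obtain c where "0 < c" "0 < x" "x < distribution c" by auto
  then show ?thesis using le_rearr[of c x] by simp
qed (simp add: rearr_eq Let_def)

lemma rearr_antimono: "0 < x \<Longrightarrow> x \<le> y \<Longrightarrow> rearr y \<le> rearr x"
proof (rule ccontr)
  assume xy: "0 < x" "x \<le> y" "\<not> rearr y \<le> rearr x"
  then obtain c where c: "rearr x < c" "c < rearr y" using dense by (auto simp: not_le)
  then have "0 < c" using rearr_nonneg[of x] by simp
  then have "x < distribution c" using less_distribution[of c y] c xy by simp
  then show False using le_rearr[of c x] \<open>0 < c\<close> c xy by simp
qed

lemma band_lmeasurable:
  assumes "0 \<le> a"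
  shows "{x \<in> ival \<alpha>. a < u x \<and> u x < b} \<in> lmeasurable" "open {x \<in> ival \<alpha>. a < u x \<and> u x < b}"
proof -
  have eq: "{x \<in> ival \<alpha>. a < u x \<and> u x < b} = superlevel a \<inter> u -` {..<b}" by (auto simp: superlevel_def)
  have "open (u -` {..<b})" using cont[of UNIV] by (intro open_vimage) auto
  then show op: "open {x \<in> ival \<alpha>. a < u x \<and> u x < b}"
    unfolding eq using open_superlevel by (intro open_Int) (auto simp: superlevel_def)
  show "{x \<in> ival \<alpha>. a < u x \<and> u x < b} \<in> lmeasurable"
  proof (rule lmeasurable_open[OF _ op])
    show "bounded {x \<in> ival \<alpha>. a < u x \<and> u x < b}"
      using superlevel_subset[OF assms] by (intro bounded_subset[OF bounded_Ioo[of 0 R]]) (auto simp: superlevel_def)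
  qed
qed

text \<open>The distribution function grows at least by the measure of any part \<open>V\<close> of the band between the two
levels.\<close>
lemma distribution_add_le:
  assumes "0 \<le> a" "a \<le> b" "V \<in> lmeasurable" "V \<subseteq> {x \<in> ival \<alpha>. a < u x \<and> u x \<le> b}"
  shows "distribution b + measure lebesgue V \<le> distribution a"
proof -
  have "measure lebesgue (superlevel b \<union> V) = distribution b + measure lebesgue V"
  proof -
    have "superlevel b \<inter> V = {}" using assms(4) by (auto simp: superlevel_def)
    then show ?thesis
      unfolding distribution_def using assms superlevel_lmeasurable[of b] by (simp add: measure_Un3)
  qed
  moreover have "measure lebesgue (superlevel b \<union> V) \<le> distribution a"
    unfolding distribution_def
  proof (rule measure_mono_fmeasurable)
    show "superlevel b \<union> V \<subseteq> superlevel a" using assms by (auto simp: superlevel_def)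
    have "superlevel b \<union> V \<in> lmeasurable" using assms superlevel_lmeasurable[of b] by (intro fmeasurable.Un) auto
    then show "superlevel b \<union> V \<in> sets lebesgue" by blast
    show "superlevel a \<in> lmeasurable" using assms(1) by (rule superlevel_lmeasurable)
  qed
  ultimately show ?thesis by simp
qed

text \<open>The rearrangement drops from \<open>b\<close> to \<open>a\<close> within a length at least the measure of the band
\<open>{a < u < b}\<close>, and as \<open>u\<close> maps this band onto \<open>{a<..<b}\<close>, its measure is at least \<open>(b - a) / C\<close>. The
function does cross the band: it exceeds \<open>b\<close> somewhere because \<open>superlevel b\<close> has positive measure,
and it is at most \<open>a\<close> somewhere because otherwise \<open>superlevel a\<close> would be the entire interval, whose
measure exceeds its interior point \<open>y\<close>.\<close>
lemma gap_le:
  assumes xy: "x \<in> ival \<alpha>" "y \<in> ival \<alpha>" "x < y" and ab: "rearr y < a" "a < b" "b < rearr x"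
  shows "b - a \<le> C * (y - x)"
proof -
  let ?O = "{z \<in> ival \<alpha>. a < u z \<and> u z < b}"
  have a: "0 < a" using ab rearr_nonneg[of y] by simp
  have xb: "x < distribution b" using less_distribution[of b x] ab a by simp
  have ya: "distribution a \<le> y" using le_rearr[OF a ival_pos[OF xy(2)]] ab by (meson not_le)
  have "distribution b + measure lebesgue ?O \<le> distribution a"
    using a ab by (intro distribution_add_le band_lmeasurable) auto
  then have O: "measure lebesgue ?O \<le> y - x" using xb ya by simp
  have "superlevel b \<noteq> {}" using xb ival_pos[OF xy(1)] by (auto simp: distribution_def)
  then obtain q where q: "q \<in> ival \<alpha>" "b < u q" by (auto simp: superlevel_def)
  have "\<exists>p\<in>ival \<alpha>. u p \<le> a"
  proof (rule ccontr)
    assume "\<not> (\<exists>p\<in>ival \<alpha>. u p \<le> a)"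
    then have all: "ival \<alpha> \<subseteq> superlevel a" by (auto simp: superlevel_def)
    obtain e where e: "0 < e" "ball y e \<subseteq> ival \<alpha>"
      using open_ival xy(2) by (meson open_contains_ball)
    then have y': "y + e/2 \<in> ival \<alpha>" by (auto simp: dist_real_def subset_iff)
    have "{0<..<y + e/2} \<subseteq> ival \<alpha>" using ival_mono[OF y'] by auto
    then have "{0<..<y + e/2} \<subseteq> superlevel a" using all by blast
    then have "measure lebesgue {0<..<y + e/2} \<le> distribution a"
      unfolding distribution_def using superlevel_lmeasurable a by (intro measure_mono_fmeasurable) auto
    then show False using ya e ival_pos[OF xy(2)] by simp
  qed
  then obtain p where p: "p \<in> ival \<alpha>" "u p \<le> a" by blast
  have "is_interval (ival \<alpha>)"
    unfolding is_interval_1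
  proof (intro ballI allI impI)
    fix r s t assume "r \<in> ival \<alpha>" "s \<in> ival \<alpha>" "r \<le> t \<and> t \<le> s"
    then show "t \<in> ival \<alpha>" using ival_mono[of s t] ival_pos[of r] by simp
  qed
  then have "connected (u ` ival \<alpha>)"
    using cont by (intro connected_continuous_image) (auto simp: is_interval_connected_1)
  then have "{u p..u q} \<subseteq> u ` ival \<alpha>"
    using p q by (intro connected_contains_Icc) auto
  then have sub: "{u p..u q} \<subseteq> u ` ival \<alpha>" .
  have img: "{a<..<b} \<subseteq> u ` ?O"
  proof
    fix t assume t: "t \<in> {a<..<b}"
    then have "t \<in> {u p..u q}" using p q by auto
    then obtain z where "z \<in> ival \<alpha>" "t = u z" using sub by blast
    then show "t \<in> u ` ?O" using t by auto
  qed
  obtain T where T: "u ` ?O \<subseteq> T" "T \<in> lmeasurable" "measure lebesgue T \<le> C * measure lebesgue ?O"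
    by (rule lipschitz_image_measure_bound[OF lip band_lmeasurable(2)[OF less_imp_le[OF a]] band_lmeasurable(1)[OF less_imp_le[OF a]]])
  have "b - a = measure lebesgue {a<..<b}" using ab by simp
  also have "\<dots> \<le> measure lebesgue T" using img T by (intro measure_mono_fmeasurable) auto
  also have "\<dots> \<le> C * (y - x)" using T(3) mult_left_mono[OF O C_nonneg] by simp
  finally show ?thesis .
qed

lemma rearr_lipschitz: "C-lipschitz_on (ival \<alpha>) rearr"
proof -
  have *: "rearr x - rearr y \<le> C * (y - x)" if xy: "x \<in> ival \<alpha>" "y \<in> ival \<alpha>" "x < y" for x y
  proof (rule field_le_epsilon)
    fix e :: real assume "0 < e"
    show "rearr x - rearr y \<le> C * (y - x) + e"
    proof (cases "rearr y + e/2 < rearr x - e/2")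
      case True
      then show ?thesis using gap_le[OF xy, of "rearr y + e/2" "rearr x - e/2"] \<open>0 < e\<close> by simp
    next
      case False
      moreover have "0 \<le> C * (y - x)" using C_nonneg xy by simp
      ultimately show ?thesis by (simp add: field_simps)
    qed
  qed
  show ?thesis
  proof (rule lipschitz_onI[OF _ C_nonneg])
    fix x y assume xy: "x \<in> ival \<alpha>" "y \<in> ival \<alpha>"
    then show "dist (rearr x) (rearr y) \<le> C * dist x y"
      using *[of x y] *[of y x] rearr_antimono[of x y] rearr_antimono[of y x] ival_pos
      by (cases x y rule: linorder_cases) (auto simp: dist_real_def)
  qed
qed

text \<open>Strictly between \<open>x\<close> and the measure of its superlevel set the rearrangement is constant, so a nonzero
derivative at \<open>x\<close> forces the two to coincide. In particular the rearrangement is injective on its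
regular points.\<close>
lemma regular_point_of_rearr:
  assumes x: "x \<in> ival \<alpha>" and der: "(rearr has_field_derivative d) (at x)" and "d \<noteq> 0"
  shows "0 < rearr x" "x = distribution (rearr x)"
proof -
  have x0: "0 < x" using ival_pos x by blast
  show pos: "0 < rearr x"
  proof (rule ccontr)
    assume "\<not> 0 < rearr x"
    then have "rearr x = 0" using rearr_nonneg[of x] by simp
    then have "d = 0"
      using DERIV_local_min[OF der zero_less_one] rearr_nonneg by simp
    then show False using \<open>d \<noteq> 0\<close> by simp
  qed
  show "x = distribution (rearr x)"
  proof (rule ccontr)
    assume "x \<noteq> distribution (rearr x)"
    then consider "distribution (rearr x) < x" | "x < distribution (rearr x)" by linarith
    then have "d = 0"
    proof cases
      case 1
      have "rearr y = rearr x" if y: "max 0 (distribution (rearr x)) < y" "y < x" for y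
      proof (rule antisym)
        show "rearr x \<le> rearr y" using rearr_antimono[of y x] y by simp
        have "\<not> y < distribution (rearr x)" using y by simp
        then show "rearr y \<le> rearr x" using less_distribution[OF less_imp_le[OF pos], of y] by (meson not_le)
      qed
      then show ?thesis
        using 1 x0 by (intro has_field_derivative_zero_if_locally_constant_left[OF der, of "max 0 (distribution (rearr x))"]) auto
    next
      case 2
      have "rearr y = rearr x" if y: "x < y" "y < distribution (rearr x)" for y
        using rearr_antimono[of x y] le_rearr[of "rearr x" y] y x0 pos by (simp add: order_antisym)
      then show ?thesis
        using 2 by (intro has_field_derivative_zero_if_locally_constant_right[OF der, of "distribution (rearr x)"]) auto
    qed
    then show False using \<open>d \<noteq> 0\<close> by simp
  qed
qed

text \<open>For \<open>K > \<bar>D\<bar>\<close> and small \<open>\<eta>\<close>, one of the two intervals of length \<open>\<eta>\<close> next to \<open>p\<close> lies in the band between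
the levels \<open>u p - K * \<eta>\<close> and \<open>u p\<close>, namely the one on the side where \<open>u\<close> descends, which exists because
\<open>D \<noteq> 0\<close>. So lowering the level by \<open>K * \<eta>\<close> enlarges the superlevel set by at least \<open>\<eta>\<close>, and the
rearrangement descends to the right of \<open>x\<close> with slope at least \<open>- K\<close>.\<close>
lemma rearr_slope_le:
  assumes p: "p \<in> ival \<alpha>" and derp: "(u has_field_derivative D) (at p)" "D \<noteq> 0"
    and x: "x \<in> ival \<alpha>" "x = distribution (rearr x)" and derx: "(rearr has_field_derivative d) (at x)"
    and eq: "u p = rearr x" and pos: "0 < rearr x"
  shows "\<bar>d\<bar> \<le> \<bar>D\<bar>"
proof -
  let ?c = "rearr x"
  have lim: "((\<lambda>y. (rearr y - rearr x) / (y - x)) \<longlongrightarrow> d) (at_right x)"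
    using derx unfolding has_field_derivative_iff by (rule tendsto_mono[rotated]) (simp add: at_le)
  have x0: "0 < x" using ival_pos x by blast
  have "d \<le> 0"
  proof (rule tendsto_upperbound[OF lim])
    show "eventually (\<lambda>y. (rearr y - rearr x) / (y - x) \<le> 0) (at_right x)"
      using rearr_antimono[OF x0] by (intro eventually_at_rightI[of x "x + 1"]) (auto simp: divide_nonpos_pos)
  qed simp
  have "- K \<le> d" if K: "\<bar>D\<bar> < K" for K
  proof -
    have "0 < K" using K by simp
    obtain \<delta>1 where \<delta>1: "0 < \<delta>1" "\<And>y. \<bar>y - p\<bar> < \<delta>1 \<Longrightarrow> y \<noteq> p \<Longrightarrow> \<bar>(u y - u p) / (y - p) - D\<bar> < K - \<bar>D\<bar>"
      using derp(1)[unfolded has_field_derivative_iff, THEN tendstoD, of "K - \<bar>D\<bar>"] K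
      by (auto simp: eventually_at dist_real_def)
    have slope: "?c - K * \<bar>y - p\<bar> < u y" if "\<bar>y - p\<bar> < \<delta>1" "y \<noteq> p" for y
    proof -
      have "\<bar>(u y - u p) / (y - p)\<bar> < K" using \<delta>1(2)[OF that] by linarith
      then have "\<bar>u y - u p\<bar> < K * \<bar>y - p\<bar>" using that by (simp add: abs_divide divide_less_eq)
      then show ?thesis using eq by linarith
    qed
    obtain \<delta>2 where \<delta>2: "0 < \<delta>2" "ball p \<delta>2 \<subseteq> ival \<alpha>"
      using open_ival p by (meson open_contains_ball)
    have "\<exists>\<delta>>0. (\<forall>h>0. h < \<delta> \<longrightarrow> u (p - h) < u p) \<or> (\<forall>h>0. h < \<delta> \<longrightarrow> u (p + h) < u p)"
    proof (cases "0 < D")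
      case True
      from DERIV_pos_inc_left[OF derp(1) this] show ?thesis by blast
    next
      case False
      then have "D < 0" using \<open>D \<noteq> 0\<close> by simp
      from DERIV_neg_dec_right[OF derp(1) this] show ?thesis by blast
    qed
    then obtain \<delta>3 where \<delta>3: "0 < \<delta>3" "(\<forall>h>0. h < \<delta>3 \<longrightarrow> u (p - h) < u p) \<or> (\<forall>h>0. h < \<delta>3 \<longrightarrow> u (p + h) < u p)"
      by blast
    \<comment> \<open>The last bound keeps the lowered level \<open>?c - K * \<eta>\<close> positive.\<close>
    define \<delta> where "\<delta> = Min {\<delta>1, \<delta>2, \<delta>3, ?c / K}"
    have \<delta>: "0 < \<delta>" "\<delta> \<le> \<delta>1" "\<delta> \<le> \<delta>2" "\<delta> \<le> \<delta>3" "\<delta> \<le> ?c / K"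
      using \<delta>1 \<delta>2 \<delta>3 pos \<open>0 < K\<close> by (auto simp: \<delta>_def)
    have shifted: "x + \<eta> \<le> distribution (?c - K * \<eta>)" if \<eta>: "0 < \<eta>" "\<eta> < \<delta>" for \<eta>
    proof -
      have "0 \<le> ?c - K * \<eta>"
      proof -
        have "\<eta> < ?c / K" using \<eta> \<delta> by linarith
        then show ?thesis using \<open>0 < K\<close> by (simp add: field_simps)
      qed
      have "\<exists>V. V \<in> lmeasurable \<and> measure lebesgue V = \<eta> \<and> V \<subseteq> {y \<in> ival \<alpha>. ?c - K * \<eta> < u y \<and> u y \<le> ?c}"
      proof -
        have in_set: "y \<in> ival \<alpha> \<and> ?c - K * \<eta> < u y" if "\<bar>y - p\<bar> < \<eta>" "y \<noteq> p" for y
        proof -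
          have "y \<in> ball p \<delta>2" using that \<eta> \<delta> by (auto simp: dist_real_def)
          moreover have "K * \<bar>y - p\<bar> \<le> K * \<eta>" using that \<open>0 < K\<close> by (intro mult_left_mono) auto
          moreover have "?c - K * \<bar>y - p\<bar> < u y" using slope[of y] that \<eta> \<delta> by linarith
          ultimately show ?thesis using \<delta>2 by auto
        qed
        from \<delta>3(2) show ?thesis
        proof
          assume l: "\<forall>h>0. h < \<delta>3 \<longrightarrow> u (p - h) < u p"
          have "u y \<le> ?c" if "p - \<eta> < y" "y < p" for y
            using l[rule_format, of "p - y"] that \<eta> \<delta> eq by simp
          then show ?thesis
            using in_set \<eta> by (intro exI[of _ "{p - \<eta><..<p}"]) auto
        next
          assume l: "\<forall>h>0. h < \<delta>3 \<longrightarrow> u (p + h) < u p"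
          have "u y \<le> ?c" if "p < y" "y < p + \<eta>" for y
            using l[rule_format, of "y - p"] that \<eta> \<delta> eq by simp
          then show ?thesis
            using in_set \<eta> by (intro exI[of _ "{p<..<p + \<eta>}"]) auto
        qed
      qed
      then obtain V where V: "V \<in> lmeasurable" "measure lebesgue V = \<eta>"
        "V \<subseteq> {y \<in> ival \<alpha>. ?c - K * \<eta> < u y \<and> u y \<le> ?c}" by blast
      have "distribution ?c + \<eta> \<le> distribution (?c - K * \<eta>)"
        using distribution_add_le[OF _ _ V(1,3)] V(2) \<open>0 \<le> ?c - K * \<eta>\<close> \<eta> \<open>0 < K\<close> by simp
      then show ?thesis using x(2) by linarith
    qed
    have lower: "?c - K * h \<le> rearr (x + h)" if h: "0 < h" "h < \<delta>" for h
    proof -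
      have "(?c - rearr (x + h)) / K \<le> h"
        \<comment> \<open>Each \<open>\<eta>\<close> above \<open>h\<close> puts \<open>x + h\<close> strictly below the enlarged measure; then \<open>\<eta>\<close> tends to \<open>h\<close>.\<close>
      proof (rule dense_ge_bounded[OF h(2)])
        fix \<eta> assume \<eta>: "h < \<eta>" "\<eta> < \<delta>"
        have "\<eta> < ?c / K" using \<eta> \<delta> by linarith
        then have "0 < ?c - K * \<eta>" using \<open>0 < K\<close> by (simp add: field_simps)
        then have "?c - K * \<eta> \<le> rearr (x + h)"
          using shifted[of \<eta>] \<eta> h x0 by (intro le_rearr) auto
        then show "(?c - rearr (x + h)) / K \<le> \<eta>"
          using \<open>0 < K\<close> by (simp add: field_simps)
      qed
      then show ?thesis using \<open>0 < K\<close> by (simp add: field_simps)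
    qed
    have "- K \<le> (rearr y - rearr x) / (y - x)" if "x < y" "y < x + \<delta>" for y
    proof -
      have "?c - K * (y - x) \<le> rearr y" using lower[of "y - x"] that by simp
      then show ?thesis using that by (simp add: pos_le_divide_eq)
    qed
    then show "- K \<le> d"
      using \<delta>(1) by (intro tendsto_lowerbound[OF lim] eventually_at_rightI[of x "x + \<delta>"]) auto
  qed
  then have "- d \<le> K" if "\<bar>D\<bar> < K" for K
    using that by (simp add: minus_le_iff)
  then have "- d \<le> \<bar>D\<bar>"
    by (rule dense_ge)
  with \<open>d \<le> 0\<close> show ?thesis by simp
qed

end

section \<open>Substitution and the coarea inequality\<close>
lemma nn_integral_eq_integral_on:
  fixes f :: "real \<Rightarrow> real"
  assumes int: "f absolutely_integrable_on S" and nonneg: "\<And>x. x \<in> S \<Longrightarrow> 0 \<le> f x"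
  shows "(\<integral>\<^sup>+x\<in>S. ennreal (f x) \<partial>lebesgue) = ennreal (integral S f)"
proof -
  have eq: "ennreal (f x) * indicator S x = ennreal (indicator S x *\<^sub>R f x)" for x
    by (simp add: indicator_def)
  have "(\<integral>\<^sup>+x\<in>S. ennreal (f x) \<partial>lebesgue) = ennreal (LINT x|lebesgue. indicator S x *\<^sub>R f x)"
    unfolding eq using int nonneg
    by (intro nn_integral_eq_integral) (auto simp: set_integrable_def indicator_def)
  also have "(LINT x|lebesgue. indicator S x *\<^sub>R f x) = integral S f"
    using set_lebesgue_integral_eq_integral(2)[OF int] by (simp add: set_lebesgue_integral_def)
  finally show ?thesis .
qed

lemma nn_integral_injective_substitution:
  fixes g g' h :: "real \<Rightarrow> real"
  assumes S: "S \<in> sets lebesgue" and der: "\<And>x. x \<in> S \<Longrightarrow> (g has_field_derivative g' x) (at x)"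
    and inj: "inj_on g S" and nonneg: "\<And>x. x \<in> S \<Longrightarrow> 0 \<le> h (g x)"
    and int: "(\<lambda>x. \<bar>g' x\<bar> * h (g x)) absolutely_integrable_on S"
  shows "(\<integral>\<^sup>+x\<in>S. ennreal (\<bar>g' x\<bar> * h (g x)) \<partial>lebesgue) = (\<integral>\<^sup>+y\<in>g ` S. ennreal (h y) \<partial>lebesgue)"
    and "(\<lambda>y. ennreal (h y) * indicator (g ` S) y) \<in> borel_measurable lebesgue"
proof -
  have *: "h absolutely_integrable_on g ` S \<and> integral (g ` S) h = integral S (\<lambda>x. \<bar>g' x\<bar> * h (g x))"
    using has_absolute_integral_change_of_variables_1'[OF S has_field_derivative_at_within[OF der] inj] int by blast
  have "(\<integral>\<^sup>+x\<in>S. ennreal (\<bar>g' x\<bar> * h (g x)) \<partial>lebesgue) = ennreal (integral S (\<lambda>x. \<bar>g' x\<bar> * h (g x)))"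
    using int nonneg by (intro nn_integral_eq_integral_on) auto
  moreover have "(\<integral>\<^sup>+y\<in>g ` S. ennreal (h y) \<partial>lebesgue) = ennreal (integral (g ` S) h)"
    using * nonneg by (intro nn_integral_eq_integral_on) auto
  ultimately show "(\<integral>\<^sup>+x\<in>S. ennreal (\<bar>g' x\<bar> * h (g x)) \<partial>lebesgue) = (\<integral>\<^sup>+y\<in>g ` S. ennreal (h y) \<partial>lebesgue)"
    using * by simp
  have eq: "ennreal (h y) * indicator (g ` S) y = ennreal (indicator (g ` S) y *\<^sub>R h y)" for y
    by (simp add: indicator_def)
  have "(\<lambda>y. indicator (g ` S) y *\<^sub>R h y) \<in> borel_measurable lebesgue"
    using * unfolding set_integrable_def by blast
  then show "(\<lambda>y. ennreal (h y) * indicator (g ` S) y) \<in> borel_measurable lebesgue"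
    unfolding eq by simp
qed

text \<open>Near a point with nonzero derivative the difference quotients keep one sign and a distance \<open>1 / (n + 1)\<close>
from \<open>0\<close> at all scales up to \<open>1 / (n + 1)\<close>. The points with a given sign and \<open>n\<close> form a closed set \<open>F\<close>,
and on the part of \<open>F\<close> in an interval of length \<open>1 / (n + 1)\<close> the function is injective.\<close>
lemma countable_injective_partition:
  fixes u :: "real \<Rightarrow> real"
  assumes cont: "continuous_on UNIV u" and E: "E \<in> sets lebesgue"
    and der: "\<And>x. x \<in> E \<Longrightarrow> \<exists>D. D \<noteq> 0 \<and> (u has_field_derivative D) (at x)"
  shows "\<exists>A :: nat \<Rightarrow> real set. disjoint_family A \<and> (\<Union>k. A k) = E \<and>
    (\<forall>k. A k \<in> sets lebesgue) \<and> (\<forall>k. inj_on u (A k))"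
proof -
  define F where "F \<sigma> n = {x. \<forall>t. \<bar>t\<bar> \<le> 1 / (real n + 1) \<longrightarrow> t\<^sup>2 / (real n + 1) \<le> \<sigma> * ((u (x + t) - u x) * t)}"
    for \<sigma> :: real and n :: nat
  have "closed (F \<sigma> n)" for \<sigma> n
  proof -
    have "F \<sigma> n = (\<Inter>t\<in>{t. \<bar>t\<bar> \<le> 1 / (real n + 1)}. {x. t\<^sup>2 / (real n + 1) \<le> \<sigma> * ((u (x + t) - u x) * t)})"
      by (auto simp: F_def)
    moreover have "closed {x. t\<^sup>2 / (real n + 1) \<le> \<sigma> * ((u (x + t) - u x) * t)}" for t
      by (intro closed_Collect_le continuous_intros continuous_on_compose2[OF cont]) auto
    ultimately show ?thesis by (simp add: closed_INT)
  qed
  then have F: "F \<sigma> n \<in> sets lebesgue" for \<sigma> n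
    by (simp add: borel_closed)
  \<comment> \<open>The Boolean \<open>b\<close> tells whether \<open>u\<close> increases, and \<open>j\<close> numbers the intervals of length \<open>1 / (n + 1)\<close>.\<close>
  define B where "B = (\<lambda>(b, n, j). E \<inter> F (if b then 1 else -1) n \<inter>
    {real_of_int j / (real n + 1)..<(real_of_int j + 1) / (real n + 1)})"
  have B_sets: "B i \<in> sets lebesgue" for i
    using E F by (cases i) (auto simp: B_def)
  have B_inj: "inj_on u (B i)" for i
  proof (rule inj_onI, rule ccontr)
    fix x y assume xy: "x \<in> B i" "y \<in> B i" "u x = u y" "x \<noteq> y"
    obtain b n j where i: "i = (b, n, j)" by (cases i)
    have "\<bar>y - x\<bar> \<le> 1 / (real n + 1)"
      using xy by (auto simp: B_def i abs_le_iff add_divide_distrib)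
    then have "(y - x)\<^sup>2 / (real n + 1) \<le> (if b then 1 else -1) * ((u (x + (y - x)) - u x) * (y - x))"
      using xy(1) unfolding B_def i F_def by blast
    moreover have "0 < (y - x)\<^sup>2 / (real n + 1)"
      using xy(4) by (simp add: zero_less_divide_iff)
    ultimately show False using xy(3) by simp
  qed
  have B_cover: "\<exists>i. x \<in> B i" if x: "x \<in> E" for x
  proof -
    obtain D where D: "D \<noteq> 0" "(u has_field_derivative D) (at x)" using der[OF x] by blast
    have "((\<lambda>t. (u (x + t) - u x) / t) \<longlongrightarrow> D) (at 0)"
      using D(2) by (simp add: DERIV_def)
    from tendstoD[OF this, of "\<bar>D\<bar> / 2"] D(1) obtain \<delta> where
      \<delta>: "0 < \<delta>" "\<And>t. \<bar>t\<bar> < \<delta> \<Longrightarrow> t \<noteq> 0 \<Longrightarrow> \<bar>(u (x + t) - u x) / t - D\<bar> < \<bar>D\<bar> / 2"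
      by (auto simp: eventually_at dist_real_def)
    obtain n :: nat where n: "1 / (real n + 1) < min \<delta> (\<bar>D\<bar> / 2)"
      using reals_Archimedean[of "min \<delta> (\<bar>D\<bar> / 2)"] \<delta>(1) D(1) by (auto simp: inverse_eq_divide add.commute)
    define b where "b \<longleftrightarrow> 0 < D"
    have "x \<in> F (if b then 1 else -1) n"
      unfolding F_def
    proof (intro CollectI allI impI)
      fix t :: real assume t: "\<bar>t\<bar> \<le> 1 / (real n + 1)"
      let ?\<sigma> = "if b then 1 else -1 :: real"
      show "t\<^sup>2 / (real n + 1) \<le> ?\<sigma> * ((u (x + t) - u x) * t)"
      proof (cases "t = 0")
        case False
        let ?q = "(u (x + t) - u x) / t"
        have "\<bar>?q - D\<bar> < \<bar>D\<bar> / 2" using \<delta>(2)[of t] t n False by linarith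
        moreover have "\<bar>D\<bar> / 2 \<le> ?\<sigma> * q" if "\<bar>q - D\<bar> < \<bar>D\<bar> / 2" for q
          using that D(1) by (cases "0 < D") (auto simp: b_def abs_if split: if_splits)
        ultimately have "\<bar>D\<bar> / 2 \<le> ?\<sigma> * ?q" by blast
        then have "1 / (real n + 1) \<le> ?\<sigma> * ?q" using n by linarith
        then have "1 / (real n + 1) * t\<^sup>2 \<le> ?\<sigma> * ?q * t\<^sup>2" by (rule mult_right_mono) simp
        also have "?\<sigma> * ?q * t\<^sup>2 = ?\<sigma> * ((u (x + t) - u x) * t)"
          using False by (simp add: power2_eq_square)
        finally show ?thesis by simp
      qed simp
    qed
    moreover have "x \<in> {real_of_int \<lfloor>x * (real n + 1)\<rfloor> / (real n + 1)..<(real_of_int \<lfloor>x * (real n + 1)\<rfloor> + 1) / (real n + 1)}"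
      by (simp add: divide_le_eq less_divide_eq)
    ultimately show ?thesis using x by (intro exI[of _ "(b, n, \<lfloor>x * (real n + 1)\<rfloor>)"]) (auto simp: B_def)
  qed
  define A where "A = disjointed (\<lambda>k. B (from_nat k))"
  have sub: "A k \<subseteq> B (from_nat k)" for k
    unfolding A_def by (rule disjointed_subset)
  show ?thesis
  proof (intro exI[of _ A] conjI allI)
    show "disjoint_family A" unfolding A_def by (rule disjoint_family_disjointed)
    have "(\<Union>k. A k) = (\<Union>k. B (from_nat k))" unfolding A_def by (rule UN_disjointed_eq)
    also have "\<dots> = E"
    proof
      show "(\<Union>k. B (from_nat k)) \<subseteq> E" by (auto simp: B_def split: prod.splits)
      show "E \<subseteq> (\<Union>k. B (from_nat k))"
      proof
        fix x assume "x \<in> E"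
        then obtain i where "x \<in> B i" using B_cover by blast
        then have "x \<in> B (from_nat (to_nat i))" by simp
        then show "x \<in> (\<Union>k. B (from_nat k))" by blast
      qed
    qed
    finally show "(\<Union>k. A k) = E" .
    show "A k \<in> sets lebesgue" for k
      unfolding A_def using B_sets sets.range_disjointed_sets[of "\<lambda>k. B (from_nat k)" lebesgue] by blast
    show "inj_on u (A k)" for k
      using B_inj sub by (rule inj_on_subset)
  qed
qed

text \<open>The coarea formula with its level sums bounded below by finite partial sums. On each piece of
an injective partition of \<open>E\<close> the integral is an integral over the levels; at a given level the pieces
contribute the values of \<open>h\<close> at distinct points, so any finite set \<open>P\<close> of points of that level is
accounted for.\<close>
lemma coarea_lower_bound:
  fixes u u' h :: "real \<Rightarrow> real" and \<Phi> :: "real \<Rightarrow> ennreal"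
  assumes cont: "continuous_on UNIV u" and E: "E \<in> sets lebesgue"
    and der: "\<And>x. x \<in> E \<Longrightarrow> (u has_field_derivative u' x) (at x)" "\<And>x. x \<in> E \<Longrightarrow> u' x \<noteq> 0"
    and nonneg: "\<And>x. x \<in> E \<Longrightarrow> 0 \<le> h x"
    and int: "(\<lambda>x. \<bar>u' x\<bar> * h x) absolutely_integrable_on E"
    and le: "AE c in lebesgue. \<exists>P. finite P \<and> P \<subseteq> {x \<in> E. u x = c} \<and> \<Phi> c \<le> (\<Sum>x\<in>P. ennreal (h x))"
  shows "(\<integral>\<^sup>+c. \<Phi> c \<partial>lebesgue) \<le> (\<integral>\<^sup>+x\<in>E. ennreal (\<bar>u' x\<bar> * h x) \<partial>lebesgue)"
proof -
  have ex: "\<exists>D. D \<noteq> 0 \<and> (u has_field_derivative D) (at x)" if "x \<in> E" for x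
    using der that by blast
  obtain A :: "nat \<Rightarrow> real set" where A: "disjoint_family A" "(\<Union>k. A k) = E" "\<And>k. A k \<in> sets lebesgue" "\<And>k. inj_on u (A k)"
    using countable_injective_partition[OF cont E ex] by auto
  have AE: "A k \<subseteq> E" for k using A(2) by blast
  define a where "a k c = ennreal (h (inv_into (A k) u c)) * indicator (u ` A k) c" for k :: nat and c
  have inv: "inv_into (A k) u (u x) = x" if "x \<in> A k" for x k
    using A(4) that by (rule inv_into_f_f)
  have intk: "(\<lambda>x. \<bar>u' x\<bar> * h x) absolutely_integrable_on A k" for k
    using set_integrable_subset[OF int A(3) AE] .
  have piece: "(\<integral>\<^sup>+x\<in>A k. ennreal (\<bar>u' x\<bar> * h x) \<partial>lebesgue) = (\<integral>\<^sup>+c. a k c \<partial>lebesgue)"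
    "a k \<in> borel_measurable lebesgue" for k
  proof -
    let ?h = "\<lambda>c. h (inv_into (A k) u c)"
    have int': "(\<lambda>x. \<bar>u' x\<bar> * ?h (u x)) absolutely_integrable_on A k"
      by (rule iffD1[OF set_integrable_cong[OF refl] intk]) (auto simp: inv)
    have nn: "0 \<le> ?h (u x)" if "x \<in> A k" for x using nonneg AE that by (auto simp: inv)
    have d: "(u has_field_derivative u' x) (at x)" if "x \<in> A k" for x using der(1) AE that by blast
    note sub = nn_integral_injective_substitution[of "A k" u u' ?h, OF A(3) d A(4) nn int']
    have "(\<integral>\<^sup>+x\<in>A k. ennreal (\<bar>u' x\<bar> * h x) \<partial>lebesgue) = (\<integral>\<^sup>+x\<in>A k. ennreal (\<bar>u' x\<bar> * ?h (u x)) \<partial>lebesgue)"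
      by (intro nn_integral_cong) (auto simp: indicator_def inv)
    then show "(\<integral>\<^sup>+x\<in>A k. ennreal (\<bar>u' x\<bar> * h x) \<partial>lebesgue) = (\<integral>\<^sup>+c. a k c \<partial>lebesgue)"
      using sub(1) by (simp add: a_def)
    show "a k \<in> borel_measurable lebesgue"
      using sub(2) by (simp add: a_def[abs_def])
  qed
  have "(\<integral>\<^sup>+c. \<Phi> c \<partial>lebesgue) \<le> (\<integral>\<^sup>+c. (\<Sum>k. a k c) \<partial>lebesgue)"
  proof (rule nn_integral_mono_AE, rule AE_mp[OF le], rule AE_I2, rule impI)
    fix c assume "\<exists>P. finite P \<and> P \<subseteq> {x \<in> E. u x = c} \<and> \<Phi> c \<le> (\<Sum>x\<in>P. ennreal (h x))"
    then obtain P where P: "finite P" "P \<subseteq> {x \<in> E. u x = c}" "\<Phi> c \<le> (\<Sum>x\<in>P. ennreal (h x))" by blast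
    have "\<forall>x\<in>P. \<exists>k. x \<in> A k" using P(2) A(2) by blast
    then obtain \<kappa> where \<kappa>: "\<And>x. x \<in> P \<Longrightarrow> x \<in> A (\<kappa> x)" by metis
    have uP: "u x = c" if "x \<in> P" for x using P(2) that by blast
    have "inj_on \<kappa> P"
      using \<kappa> uP A(4) by (intro inj_onI) (metis inj_onD)
    have "(\<Sum>x\<in>P. ennreal (h x)) = (\<Sum>x\<in>P. a (\<kappa> x) c)"
    proof (rule sum.cong[OF refl])
      fix x assume x: "x \<in> P"
      then have "c \<in> u ` A (\<kappa> x)" using \<kappa> uP by blast
      moreover have "inv_into (A (\<kappa> x)) u c = x" using inv[OF \<kappa>[OF x]] uP[OF x] by simp
      ultimately show "ennreal (h x) = a (\<kappa> x) c" by (simp add: a_def)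
    qed
    also have "\<dots> = (\<Sum>k\<in>\<kappa> ` P. a k c)"
      using \<open>inj_on \<kappa> P\<close> by (simp add: sum.reindex)
    also have "\<dots> \<le> (\<Sum>k. a k c)"
      using P(1) by (intro sum_le_suminf) auto
    finally show "\<Phi> c \<le> (\<Sum>k. a k c)" using P(3) by simp
  qed
  also have "\<dots> = (\<Sum>k. \<integral>\<^sup>+c. a k c \<partial>lebesgue)"
    using piece(2) by (rule nn_integral_suminf)
  also have "\<dots> = (\<Sum>k. \<integral>\<^sup>+x\<in>A k. ennreal (\<bar>u' x\<bar> * h x) \<partial>lebesgue)"
    by (simp add: piece(1))
  also have "\<dots> = (\<integral>\<^sup>+x. (\<Sum>k. ennreal (\<bar>u' x\<bar> * h x) * indicator (A k) x) \<partial>lebesgue)"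
  proof (rule nn_integral_suminf[symmetric])
    fix k
    have "(\<lambda>x. indicator (A k) x *\<^sub>R (\<bar>u' x\<bar> * h x)) \<in> borel_measurable lebesgue"
      using intk[of k] unfolding set_integrable_def by blast
    moreover have "ennreal (\<bar>u' x\<bar> * h x) * indicator (A k) x = ennreal (indicator (A k) x *\<^sub>R (\<bar>u' x\<bar> * h x))" for x
      by (simp add: indicator_def)
    ultimately show "(\<lambda>x. ennreal (\<bar>u' x\<bar> * h x) * indicator (A k) x) \<in> borel_measurable lebesgue"
      by simp
  qed
  also have "\<dots> = (\<integral>\<^sup>+x\<in>E. ennreal (\<bar>u' x\<bar> * h x) \<partial>lebesgue)"
    using A(1,2) by (simp add: suminf_indicator)
  finally show ?thesis .
qed

lemma deriv_lipschitz_le: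
  fixes u :: "real \<Rightarrow> real"
  assumes lip: "C-lipschitz_on UNIV u" and der: "(u has_field_derivative D) (at x)"
  shows "\<bar>D\<bar> \<le> C"
proof -
  have "((\<lambda>t. \<bar>(u (x + t) - u x) / t\<bar>) \<longlongrightarrow> \<bar>D\<bar>) (at 0)"
    using der by (intro tendsto_rabs) (simp add: DERIV_def)
  moreover have "\<bar>(u (x + t) - u x) / t\<bar> \<le> C" if "t \<noteq> 0" for t
    using lipschitz_onD[OF lip, of "x + t" x] that by (simp add: dist_real_def abs_divide divide_le_eq)
  then have "eventually (\<lambda>t. \<bar>(u (x + t) - u x) / t\<bar> \<le> C) (at 0)"
    by (auto simp: eventually_at intro!: exI[of _ 1])
  ultimately show ?thesis
    by (rule tendsto_upperbound) simp
qed

lemma deriv_borel_measurable: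
  fixes u :: "real \<Rightarrow> real"
  assumes cont: "continuous_on UNIV u" and E: "E \<in> sets lebesgue"
    and der: "\<And>x. x \<in> E \<Longrightarrow> u differentiable (at x)"
  shows "deriv u \<in> borel_measurable (lebesgue_on E)"
proof (rule borel_measurable_LIMSEQ_real)
  show "(\<lambda>x. (u (x + inverse (real (Suc n))) - u x) / inverse (real (Suc n))) \<in> borel_measurable (lebesgue_on E)" for n
    by (intro continuous_imp_measurable_on_sets_lebesgue[OF _ E] continuous_intros continuous_on_compose2[OF cont]) auto
  fix x assume x: "x \<in> space (lebesgue_on E)"
  have "(u has_field_derivative deriv u x) (at x)"
    using der x by (simp add: DERIV_deriv_iff_real_differentiable)
  then have "((\<lambda>t. (u (x + t) - u x) / t) \<longlongrightarrow> deriv u x) (at 0)"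
    by (simp add: DERIV_def)
  moreover have "filterlim (\<lambda>n. inverse (real (Suc n))) (at 0) sequentially"
    using LIMSEQ_inverse_real_of_nat by (simp add: filterlim_at)
  ultimately show "(\<lambda>n. (u (x + inverse (real (Suc n))) - u x) / inverse (real (Suc n))) \<longlonglongrightarrow> deriv u x"
    by (rule filterlim_compose)
qed

text \<open>On a bounded set the integrand is bounded, since \<open>\<bar>u'\<bar> \<le> C\<close>, and it is measurable because the
derivative is a limit of continuous difference quotients.\<close>
lemma integrand_absolutely_integrable:
  fixes u f :: "real \<Rightarrow> real" and G :: "real \<Rightarrow> real \<Rightarrow> real"
  assumes lip: "C-lipschitz_on UNIV u" and E: "E \<in> sets lebesgue" "E \<subseteq> K" "compact K"
    and der: "\<And>x. x \<in> E \<Longrightarrow> u differentiable (at x)" and nonneg: "\<And>x. x \<in> E \<Longrightarrow> 0 \<le> u x"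
    and f: "continuous_on K f"
    and G: "continuous_on ({0..} \<times> {0..}) (\<lambda>(z, v). G z v)"
  shows "(\<lambda>x. G \<bar>deriv u x\<bar> (u x) * f x) absolutely_integrable_on E"
proof -
  have contu: "continuous_on S u" for S
    using lipschitz_on_continuous_on[OF lip] continuous_on_subset by blast
  \<comment> \<open>Absolute values extend \<open>G\<close> continuously from the quadrant to the plane.\<close>
  have Gabs: "continuous_on UNIV (\<lambda>p. G \<bar>fst p\<bar> \<bar>snd p\<bar>)"
  proof -
    have "continuous_on UNIV (\<lambda>p. (\<lambda>(z, v). G z v) (\<bar>fst p\<bar>, \<bar>snd p\<bar>))"
      by (rule continuous_on_compose2[OF G]) (auto intro!: continuous_intros)
    then show ?thesis by simp
  qed
  have "(\<lambda>x. (\<lambda>p. G \<bar>fst p\<bar> \<bar>snd p\<bar>) (deriv u x, u x)) \<in> borel_measurable (lebesgue_on E)"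
  proof (rule measurable_compose[of "\<lambda>x. (deriv u x, u x)" _ borel "\<lambda>p. G \<bar>fst p\<bar> \<bar>snd p\<bar>"])
    show "(\<lambda>x. (deriv u x, u x)) \<in> borel_measurable (lebesgue_on E)"
      by (intro borel_measurable_Pair deriv_borel_measurable[OF contu E(1) der]
          continuous_imp_measurable_on_sets_lebesgue[OF contu E(1)])
    show "(\<lambda>p. G \<bar>fst p\<bar> \<bar>snd p\<bar>) \<in> borel_measurable borel"
      using Gabs by (rule borel_measurable_continuous_onI)
  qed
  moreover have "f \<in> borel_measurable (lebesgue_on E)"
    using continuous_on_subset[OF f E(2)] E(1) by (rule continuous_imp_measurable_on_sets_lebesgue)
  ultimately have meas: "(\<lambda>x. G \<bar>deriv u x\<bar> \<bar>u x\<bar> * f x) \<in> borel_measurable (lebesgue_on E)"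
    by simp
  have "compact (u ` K)" using contu E(3) by (rule compact_continuous_image)
  then have "bounded (u ` K)" by (rule compact_imp_bounded)
  then obtain B where B: "\<And>x. x \<in> K \<Longrightarrow> \<bar>u x\<bar> \<le> B" by (auto simp: bounded_iff)
  have "compact ((\<lambda>p. G \<bar>fst p\<bar> \<bar>snd p\<bar>) ` ({0..C} \<times> {0..B}))"
    by (intro compact_continuous_image compact_Times compact_Icc continuous_on_subset[OF Gabs]) auto
  then have "bounded ((\<lambda>p. G \<bar>fst p\<bar> \<bar>snd p\<bar>) ` ({0..C} \<times> {0..B}))" by (rule compact_imp_bounded)
  then obtain M where M: "\<And>p. p \<in> {0..C} \<times> {0..B} \<Longrightarrow> \<bar>G \<bar>fst p\<bar> \<bar>snd p\<bar>\<bar> \<le> M"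
    unfolding bounded_iff by (metis (no_types, lifting) imageI real_norm_def)
  have "bounded (f ` K)" using compact_continuous_image[OF f E(3)] by (rule compact_imp_bounded)
  then obtain N where N: "\<And>x. x \<in> K \<Longrightarrow> \<bar>f x\<bar> \<le> N" by (auto simp: bounded_iff)
  have "E \<in> lmeasurable"
    using E bounded_set_imp_lmeasurable bounded_subset compact_imp_bounded by metis
  then have const: "(\<lambda>x. M * N) integrable_on E" by (rule integrable_on_const)
  have "(\<lambda>x. G \<bar>deriv u x\<bar> \<bar>u x\<bar> * f x) absolutely_integrable_on E"
  proof (rule measurable_bounded_by_integrable_imp_absolutely_integrable[OF meas E(1) const])
    fix x assume x: "x \<in> E"
    then have "\<bar>deriv u x\<bar> \<le> C"
      using der by (intro deriv_lipschitz_le[OF lip, of _ x]) (simp add: DERIV_deriv_iff_real_differentiable)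
    then have "\<bar>G \<bar>deriv u x\<bar> \<bar>u x\<bar>\<bar> \<le> M"
      using M[of "(\<bar>deriv u x\<bar>, \<bar>u x\<bar>)"] B[of x] x E(2) by auto
    moreover have "\<bar>f x\<bar> \<le> N" using N x E(2) by blast
    ultimately show "norm (G \<bar>deriv u x\<bar> \<bar>u x\<bar> * f x) \<le> M * N"
      by (simp add: abs_mult mult_mono')
  qed
  then show ?thesis
    by (rule iffD1[OF set_integrable_cong[OF refl refl], rotated]) (simp add: nonneg)
qed

section \<open>Level sets at almost every height\<close>
lemma locally_injective_at_regular_point:
  fixes u :: "real \<Rightarrow> real"
  assumes "(u has_field_derivative D) (at x)" "D \<noteq> 0"
  shows "eventually (\<lambda>y. u y \<noteq> u x) (at x)"
proof -
  have "eventually (\<lambda>y. (u y - u x) / (y - x) \<noteq> 0) (at x)"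
    using assms by (intro tendsto_imp_eventually_ne[of _ D]) (auto simp: has_field_derivative_iff)
  then show ?thesis by eventually_elim auto
qed

lemma closure_ival:
  assumes "x \<in> closure (ival \<alpha>)"
  shows "0 \<le> x" "ereal x \<le> \<alpha>"
proof -
  have "closed {x::real. 0 \<le> x \<and> ereal x \<le> \<alpha>}"
  proof (cases \<alpha>)
    case (real r)
    then have "{x::real. 0 \<le> x \<and> ereal x \<le> \<alpha>} = {0..r}" by auto
    then show ?thesis by simp
  next
    case PInf
    then have "{x::real. 0 \<le> x \<and> ereal x \<le> \<alpha>} = {0..}" by auto
    then show ?thesis by simp
  qed simp
  then have "closure (ival \<alpha>) \<subseteq> {x::real. 0 \<le> x \<and> ereal x \<le> \<alpha>}"
    by (intro closure_minimal) (auto simp: ival_def)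
  then show "0 \<le> x" "ereal x \<le> \<alpha>" using assms by auto
qed

lemma zero_in_closure_ival:
  assumes "x \<in> ival \<alpha>" shows "0 \<in> closure (ival \<alpha>)"
proof -
  have x: "0 < x" "ereal x < \<alpha>" using assms by (auto simp: ival_def)
  have "{0<..<x} \<subseteq> ival \<alpha>"
  proof
    fix y assume "y \<in> {0<..<x}"
    then have "0 < y" "ereal y < ereal x" by auto
    then show "y \<in> ival \<alpha>" using less_trans[of "ereal y" "ereal x" \<alpha>] x(2) by (simp add: ival_def)
  qed
  then have "closure {0<..<x} \<subseteq> closure (ival \<alpha>)" by (rule closure_mono)
  then show ?thesis using x(1) by auto
qed

context profile
begin

text \<open>The levels to be avoided: besides values at singular and at critical points, the values at the two
end points, where level points might otherwise accumulate. If \<open>\<alpha> = \<infinity>\<close>, then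
\<open>real_of_ereal \<alpha> = 0\<close> and the last value repeats the one before it.\<close>
definition critical_values :: "real set" where
  "critical_values = u ` {x. \<not> u differentiable (at x)} \<union>
     u ` {x \<in> {0..R}. (u has_field_derivative 0) (at x)} \<union> {u 0, u (real_of_ereal \<alpha>)}"

lemma negligible_critical_values: "negligible critical_values"
proof -
  have "negligible (u ` {x. \<not> u differentiable (at x)})"
  proof (rule negligible_locally_Lipschitz_image)
    show "negligible {x. \<not> u differentiable (at x)}" using lip by (rule lipschitz_differentiable_ae)
    show "\<exists>T B. open T \<and> x \<in> T \<and> (\<forall>y\<in>{x. \<not> u differentiable (at x)} \<inter> T. norm (u y - u x) \<le> B * norm (y - x))" for x
      using u_abs by (intro exI[of _ UNIV] exI[of _ C]) auto
  qed simp
  moreover have "negligible (u ` {x \<in> {0..R}. (u has_field_derivative 0) (at x)})"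
    by (rule critical_values_negligible[OF lip]) (auto intro: bounded_subset[of "{0..R}"])
  ultimately show ?thesis
    by (auto simp: critical_values_def intro!: negligible_Un)
qed

lemma level_point:
  assumes c: "0 < c" "c \<notin> critical_values" and p: "p \<in> ival \<alpha>" "u p = c"
  shows "p < R" "(u has_field_derivative deriv u p) (at p)" "deriv u p \<noteq> 0"
proof -
  show "p < R" using supp[OF p(1)] c p(2) by (cases "p < R") auto
  have "u differentiable (at p)" using c(2) p(2) by (auto simp: critical_values_def)
  then show *: "(u has_field_derivative deriv u p) (at p)"
    by (simp add: DERIV_deriv_iff_real_differentiable)
  show "deriv u p \<noteq> 0"
  proof
    assume "deriv u p = 0"
    then have "p \<in> {x \<in> {0..R}. (u has_field_derivative 0) (at x)}"
      using * \<open>p < R\<close> ival_pos[OF p(1)] by simp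
    then show False using c(2) p(2) by (auto simp: critical_values_def)
  qed
qed

text \<open>An infinite level set would accumulate in the closure of the interval. Accumulation points are of the
same level, so they are neither end points nor interior points, as at the latter the derivative is
nonzero and level points are isolated.\<close>
lemma finite_level_set:
  assumes c: "0 < c" "c \<notin> critical_values"
  shows "finite {x \<in> ival \<alpha>. u x = c}"
proof (rule ccontr)
  let ?P = "{x \<in> ival \<alpha>. u x = c}"
  assume inf: "infinite ?P"
  have "?P \<subseteq> {0..R}"
    using level_point(1)[OF c] ival_pos by (force intro: less_imp_le)
  then obtain a where a: "a \<in> {0..R}" "a islimpt ?P"
    using inf Heine_Borel_imp_Bolzano_Weierstrass[of "{0..R}" ?P] by auto
  have "closed {x. u x = c}"
    using cont[of UNIV] by (intro closed_Collect_eq) auto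
  then have ua: "u a = c"
    using a(2) islimpt_subset[OF a(2), of "{x. u x = c}"] by (auto simp: closed_limpt)
  have "a \<in> closure (ival \<alpha>)"
    using islimpt_subset[OF a(2), of "ival \<alpha>"] by (auto simp: closure_def)
  then have "0 \<le> a" "ereal a \<le> \<alpha>" by (rule closure_ival)+
  moreover have "a \<noteq> 0" "a \<noteq> real_of_ereal \<alpha>"
    using ua c(2) by (auto simp: critical_values_def)
  ultimately have "a \<in> ival \<alpha>"
    by (cases \<alpha>) (auto simp: ival_def)
  then have "eventually (\<lambda>y. u y \<noteq> u a) (at a)"
    using level_point(2,3)[OF c _ ua] by (intro locally_injective_at_regular_point)
  then have "eventually (\<lambda>y. y \<notin> ?P) (at a)"
    by eventually_elim (use ua in auto)
  then show False
    using a(2) by (simp only: islimpt_conv_frequently_at frequently_def) simp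
qed

lemma superlevel_membership_constant:
  assumes "0 < x" "x \<le> y" "y \<in> ival \<alpha>" "{x..y} \<inter> {x \<in> ival \<alpha>. u x = c} = {}"
  shows "x \<in> superlevel c \<longleftrightarrow> y \<in> superlevel c"
proof (rule ccontr)
  assume ne: "\<not> (x \<in> superlevel c \<longleftrightarrow> y \<in> superlevel c)"
  have sub: "{x..y} \<subseteq> ival \<alpha>" using ival_mono[OF assms(3)] assms(1) by auto
  have "connected (u ` {x..y})" using cont by (intro connected_continuous_image) auto
  moreover have "u x \<in> u ` {x..y}" "u y \<in> u ` {x..y}" using assms(2) by auto
  ultimately have "{u x..u y} \<subseteq> u ` {x..y}" "{u y..u x} \<subseteq> u ` {x..y}"
    using connected_contains_Icc by metis+
  moreover have "c \<in> {u x..u y} \<union> {u y..u x}"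
    using ne sub assms(2) by (auto simp: superlevel_def)
  ultimately have "c \<in> u ` {x..y}" by blast
  then show False using assms(4) sub by auto
qed

text \<open>If \<open>\<alpha> = \<infinity>\<close>, the superlevel set stays away from points beyond \<open>R\<close>, and \<open>alternating_sum_bound\<close> applies
to it directly. If \<open>\<alpha>\<close> is finite and the superlevel set reaches up to \<open>\<alpha>\<close>, the bound applies to its
complement, and \<open>f x = f (\<alpha> - x)\<close> carries it over.\<close>
lemma perimeter_bound:
  assumes wf: "weight \<alpha> f" and c: "0 < c" and fin: "finite {x \<in> ival \<alpha>. u x = c}"
    and mI: "distribution c \<in> ival \<alpha>"
  shows "f (distribution c) \<le> (\<Sum>p\<in>{x \<in> ival \<alpha>. u x = c}. f p)"
proof -
  let ?P = "{x \<in> ival \<alpha>. u x = c}"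
  have cl: "ival \<alpha> \<subseteq> closure (ival \<alpha>)" by (rule closure_subset)
  have zero: "0 \<in> closure (ival \<alpha>)" using zero_in_closure_ival[OF mI] .
  have sub: "f (y - x) \<le> f x + f y" if "0 \<le> x" "x \<le> y" "y \<in> ival \<alpha>" for x y
  proof -
    have "x \<in> closure (ival \<alpha>)"
      using that zero ival_mono[OF that(3), of x] cl by (cases "x = 0") auto
    moreover have "y \<in> closure (ival \<alpha>)" using that(3) cl by blast
    ultimately show ?thesis using wf that(2) by (auto simp: weight_def)
  qed
  have pos: "0 \<le> f x" if "x \<in> ival \<alpha>" for x
    using wf that by (auto simp: weight_def intro: less_imp_le)
  have lset: "superlevel c \<in> sets lebesgue" using superlevel_lmeasurable[of c] c by auto
  have PR: "p < R" if "p \<in> ?P" for p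
    using supp[of p] c that by (auto simp: not_le[symmetric])
  have m0: "0 < distribution c" using ival_pos mI by blast
  show ?thesis
  proof (cases "\<exists>r. \<alpha> = ereal r")
    case False
    then have I: "ival \<alpha> = {0<..}"
      using mI by (cases \<alpha>) (auto simp: ival_def)
    \<comment> \<open>Cutting off at \<open>R + 1\<close> makes \<open>R\<close>, where \<open>u\<close> vanishes, a point of the last gap.\<close>
    have superlevel_eq: "superlevel c \<inter> {0<..<R + 1} = superlevel c" using superlevel_subset[of c] c by auto
    have "measure lebesgue (superlevel c \<inter> {0<..<R + 1}) = 0 \<or>
      f (measure lebesgue (superlevel c \<inter> {0<..<R + 1})) \<le> sum f ?P"
    proof (rule alternating_sum_bound[where J = "ival \<alpha>", OF fin sub pos lset])
      show "?P \<subseteq> {0<..<R + 1}" using PR ival_pos by force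
      show "x \<in> superlevel c \<longleftrightarrow> y \<in> superlevel c" if "0 < x" "x \<le> y" "y < R + 1" "{x..y} \<inter> ?P = {}" for x y
        using that I by (intro superlevel_membership_constant) auto
      show "x \<notin> superlevel c" if x: "0 < x" "x < R + 1" "\<forall>p\<in>?P. p < x" for x
      proof
        assume "x \<in> superlevel c"
        then have "x \<le> R" using superlevel_subset[of c] c by auto
        moreover have "{x..R} \<inter> ?P = {}" using x(3) by force
        ultimately have "R \<in> superlevel c"
          using superlevel_membership_constant[of x R c] x(1) \<open>x \<in> superlevel c\<close> I R_pos by auto
        then show False using superlevel_subset[of c] c by auto
      qed
    qed auto
    then show ?thesis using superlevel_eq m0 by (simp add: distribution_def)
  next
    case True
    then obtain r where r: "\<alpha> = ereal r" by blast
    have I: "ival \<alpha> = {0<..<r}" by (auto simp: ival_def r)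
    have superlevel_eq: "superlevel c \<inter> {0<..<r} = superlevel c" by (auto simp: superlevel_def I)
    have const: "x \<in> superlevel c \<longleftrightarrow> y \<in> superlevel c" if "0 < x" "x \<le> y" "y < r" "{x..y} \<inter> ?P = {}" for x y
      using that I by (intro superlevel_membership_constant) auto
    show ?thesis
    proof (cases "\<forall>x. 0 < x \<and> x < r \<and> (\<forall>p\<in>?P. p < x) \<longrightarrow> x \<notin> superlevel c")
      case True
      have "measure lebesgue (superlevel c \<inter> {0<..<r}) = 0 \<or> f (measure lebesgue (superlevel c \<inter> {0<..<r})) \<le> sum f ?P"
      proof (rule alternating_sum_bound[where J = "ival \<alpha>", OF fin sub pos lset])
        show "?P \<subseteq> {0<..<r}" by (auto simp: I)
      qed (use const True in auto)
      then show ?thesis using superlevel_eq m0 by (simp add: distribution_def)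
    next
      case False
      then obtain z where z: "0 < z" "z < r" "\<forall>p\<in>?P. p < z" "z \<in> superlevel c" by blast
      have "measure lebesgue (- superlevel c \<inter> {0<..<r}) = 0 \<or> f (measure lebesgue (- superlevel c \<inter> {0<..<r})) \<le> sum f ?P"
      proof (rule alternating_sum_bound[where J = "ival \<alpha>", OF fin sub pos])
        show "- superlevel c \<in> sets lebesgue" using lset by (simp add: Compl_in_sets_lebesgue)
        show "?P \<subseteq> {0<..<r}" by (auto simp: I)
        show "x \<in> - superlevel c \<longleftrightarrow> y \<in> - superlevel c" if "0 < x" "x \<le> y" "y < r" "{x..y} \<inter> ?P = {}" for x y
          using const[OF that] by simp
        show "x \<notin> - superlevel c" if x: "0 < x" "x < r" "\<forall>p\<in>?P. p < x" for x
        proof (cases "x \<le> z")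
          case True
          then have "{x..z} \<inter> ?P = {}" using x(3) by force
          then show ?thesis using const[of x z] True x z by auto
        next
          case False
          then have "{z..x} \<inter> ?P = {}" using z(3) by force
          then show ?thesis using const[of z x] False x z by auto
        qed
      qed auto
      moreover have "measure lebesgue (- superlevel c \<inter> {0<..<r}) = r - distribution c"
      proof -
        have "- superlevel c \<inter> {0<..<r} = {0<..<r} - superlevel c" by blast
        moreover have "measure lebesgue ({0<..<r} - superlevel c) = measure lebesgue {0<..<r} - measure lebesgue (superlevel c)"
          using superlevel_eq c superlevel_lmeasurable[of c] by (intro measurable_measure_Diff) auto
        ultimately show ?thesis using mI I by (simp add: distribution_def)
      qed
      moreover have "distribution c < r" using mI I by simp
      moreover have "f (r - distribution c) = f (distribution c)"
        using wf mI cl by (auto simp: weight_def r)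
      ultimately show ?thesis by simp
    qed
  qed
qed

end

section \<open>The rearrangement inequality\<close>
lemma deriv_eq_if_eq_on_open:
  fixes f g :: "real \<Rightarrow> real"
  assumes "open S" "x \<in> S" "\<And>y. y \<in> S \<Longrightarrow> f y = g y"
  shows "deriv f x = deriv g x"
proof (rule deriv_cong_ev[OF _ refl])
  show "\<forall>\<^sub>F y in nhds x. f y = g y"
    using assms by (auto simp: eventually_nhds)
qed

lemma regular_points_measurable:
  fixes u :: "real \<Rightarrow> real"
  assumes lip: "C-lipschitz_on UNIV u" and S: "S \<in> sets lebesgue"
  shows "{x \<in> S. u differentiable (at x) \<and> deriv u x \<noteq> 0} \<in> sets lebesgue"
proof -
  define S' where "S' = S - {x. \<not> u differentiable (at x)}"
  have S': "S' \<in> sets lebesgue"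
    unfolding S'_def using S lipschitz_differentiable_ae[OF lip] by (auto intro: negligible_imp_sets)
  have "deriv u \<in> borel_measurable (lebesgue_on S')"
    using lipschitz_on_continuous_on[OF lip] S' by (rule deriv_borel_measurable) (auto simp: S'_def)
  then have "deriv u -` (- {0}) \<inter> space (lebesgue_on S') \<in> sets (lebesgue_on S')"
    by (rule measurable_sets) auto
  then have "deriv u -` (- {0}) \<inter> S' \<in> sets lebesgue"
    using S' by (simp add: sets_restrict_space_iff)
  also have "deriv u -` (- {0}) \<inter> S' = {x \<in> S. u differentiable (at x) \<and> deriv u x \<noteq> 0}"
    by (auto simp: S'_def)
  finally show ?thesis .
qed

theorem theorem2p10:
  fixes \<alpha> :: ereal and f :: "real \<Rightarrow> real" and G :: "real \<Rightarrow> real \<Rightarrow> real" and u :: "real \<Rightarrow> real"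
  assumes "0 < \<alpha>"
    and "weight \<alpha> f"
    and "\<And>z v. 0 \<le> z \<Longrightarrow> 0 \<le> v \<Longrightarrow> 0 \<le> G z v"
    and "continuous_on ({0..} \<times> {0..}) (\<lambda>(z, v). G z v)"
    and "\<And>v. 0 \<le> v \<Longrightarrow> G 0 v = 0"
    and "\<And>v. 0 \<le> v \<Longrightarrow> mono_on {0<..} (\<lambda>z. G z v / z)"
    and "u \<in> class_L \<alpha>"
  shows "(\<integral>\<^sup>+x\<in>ival \<alpha>. ennreal (G \<bar>deriv u x\<bar> (u x) * f x) \<partial>lebesgue)
       \<ge> (\<integral>\<^sup>+x\<in>ival \<alpha>. ennreal (G \<bar>deriv (decr_rearr \<alpha> u) x\<bar> (decr_rearr \<alpha> u x) * f x) \<partial>lebesgue)"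
proof -
  let ?I = "ival \<alpha>"
  obtain e where "0 < ereal e" "ereal e < \<alpha>"
    using ereal_dense2[OF assms(1)] by blast
  then have "?I \<noteq> {}" by (auto simp: ival_def)
  obtain C where "C-lipschitz_on ?I u" using assms(7) by (auto simp: class_L_def)
  then obtain U where U: "C-lipschitz_on UNIV U" "\<And>x. x \<in> ?I \<Longrightarrow> U x = u x"
    using lipschitz_extension \<open>?I \<noteq> {}\<close> by metis
  have "bounded (support_on ?I u)"
    using assms(7) bounded_subset[OF compact_imp_bounded closure_subset] by (auto simp: class_L_def)
  then obtain R where R: "0 < R" "support_on ?I u \<subseteq> ball 0 R"
    using bounded_subset_ballD by blast
  have u_supp: "u x = 0" if "x \<in> ?I" "R \<le> x" for x
    using R that by (force simp: support_on_def)
  interpret profile \<alpha> U C R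
    by unfold_locales (use U R u_supp assms(7) in \<open>auto simp: class_L_def class_S_def\<close>)
  have decr_rearr_eq: "decr_rearr \<alpha> u = rearr"
  proof -
    have "{y \<in> ?I. c < u y} = {y \<in> ?I. c < U y}" for c using U(2) by auto
    then show ?thesis by (simp add: rearr_def decr_rearr_def fun_eq_iff)
  qed
  obtain V where V: "C-lipschitz_on UNIV V" "\<And>x. x \<in> ?I \<Longrightarrow> V x = rearr x"
    using lipschitz_extension[OF rearr_lipschitz \<open>?I \<noteq> {}\<close>] by metis
  have dU: "deriv u x = deriv U x" if "x \<in> ?I" for x
    by (rule deriv_eq_if_eq_on_open[OF open_ival that]) (simp add: U)
  have dV: "deriv rearr x = deriv V x" if "x \<in> ?I" for x
    by (rule deriv_eq_if_eq_on_open[OF open_ival that]) (simp add: V)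
  define E where "E = {x \<in> ?I \<inter> {..<R}. U differentiable (at x) \<and> deriv U x \<noteq> 0}"
  define D where "D = {x \<in> ?I. V differentiable (at x) \<and> deriv V x \<noteq> 0}"
  have I_sets: "?I \<in> sets lebesgue" using open_ival by (simp add: borel_open)
  have E_sets: "E \<in> sets lebesgue"
    unfolding E_def using I_sets by (intro regular_points_measurable[OF U(1)]) auto
  have D_sets: "D \<in> sets lebesgue"
    unfolding D_def using I_sets by (intro regular_points_measurable[OF V(1)]) auto
  have EU: "(U has_field_derivative deriv U x) (at x)" "deriv U x \<noteq> 0" "x \<in> ?I" "x < R" "U differentiable (at x)" if "x \<in> E" for x
    using that by (auto simp: E_def DERIV_deriv_iff_real_differentiable)
  have DV: "(V has_field_derivative deriv V x) (at x)" "deriv V x \<noteq> 0" "x \<in> ?I" "V differentiable (at x)" if "x \<in> D" for x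
    using that by (auto simp: D_def DERIV_deriv_iff_real_differentiable)
  have Dw: "(rearr has_field_derivative deriv V x) (at x)" if "x \<in> D" for x
    using DV(1)[OF that] open_ival DV(3)[OF that]
    by (rule has_field_derivative_transform_within_open) (simp add: V)
  have reg: "0 < rearr x" "x = distribution (rearr x)" if "x \<in> D" for x
    using regular_point_of_rearr[OF DV(3) Dw DV(2)] that by blast+
  have D_le: "x \<le> R" if "x \<in> D" for x
  proof -
    have "distribution (rearr x) \<le> measure lebesgue {0<..<R}"
      unfolding distribution_def using superlevel_subset[OF rearr_nonneg] superlevel_lmeasurable[OF rearr_nonneg]
      by (intro measure_mono_fmeasurable) auto
    then show ?thesis using reg(2)[OF that] R(1) by simp
  qed
  let ?K = "closure ?I \<inter> {0..R}"
  have K: "compact ?K" by (intro closed_Int_compact) auto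
  have fK: "continuous_on ?K f"
    using assms(2) by (auto simp: weight_def intro: continuous_on_subset)
  have f_pos: "0 < f x" if "x \<in> ?I" for x using assms(2) that by (auto simp: weight_def)
  have IK: "x \<in> ?K" if "x \<in> ?I" "x \<le> R" for x
    using that closure_subset[of ?I] ival_pos[OF that(1)] by auto
  \<comment> \<open>The densities in the level variable: \<open>h\<close> is attached to points of \<open>E\<close>, but \<open>k\<close> to levels, as the
    regular point of the rearrangement at level \<open>c\<close> is \<open>distribution c\<close>.\<close>
  define h where "h x = G \<bar>deriv U x\<bar> (U x) / \<bar>deriv U x\<bar> * f x" for x
  define k where "k c = G \<bar>deriv V (distribution c)\<bar> c / \<bar>deriv V (distribution c)\<bar> * f (distribution c)" for c
  have h_eq: "\<bar>deriv U x\<bar> * h x = G \<bar>deriv U x\<bar> (U x) * f x" if "x \<in> E" for x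
    using EU(2)[OF that] by (simp add: h_def)
  have k_eq: "\<bar>deriv V x\<bar> * k (V x) = G \<bar>deriv V x\<bar> (rearr x) * f x" if "x \<in> D" for x
    using DV(2)[OF that] V(2)[OF DV(3)[OF that]] reg(2)[OF that] by (simp add: k_def)
  have h_nonneg: "0 \<le> h x" if "x \<in> E" for x
    using assms(3)[of "\<bar>deriv U x\<bar>" "U x"] nonneg EU(3)[OF that] f_pos[OF EU(3)[OF that]] by (simp add: h_def)
  have k_nonneg: "0 \<le> k (V x)" if "x \<in> D" for x
    using assms(3)[of "\<bar>deriv V x\<bar>" "rearr x"] rearr_nonneg[of x] f_pos[OF DV(3)[OF that]]
      V(2)[OF DV(3)[OF that]] reg(2)[OF that] by (simp add: k_def)
  have EK: "E \<subseteq> ?K" using IK EU(3,4) by (meson less_imp_le subsetI)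
  have DK: "D \<subseteq> ?K" using IK DV(3) D_le by blast
  have "(\<lambda>x. G \<bar>deriv U x\<bar> (U x) * f x) absolutely_integrable_on E"
    using EU nonneg by (intro integrand_absolutely_integrable[OF U(1) E_sets EK K _ _ fK assms(4)]) auto
  then have h_int: "(\<lambda>x. \<bar>deriv U x\<bar> * h x) absolutely_integrable_on E"
    by (rule iffD1[OF set_integrable_cong[OF refl refl], rotated]) (simp add: h_eq)
  have "(\<lambda>x. G \<bar>deriv V x\<bar> (V x) * f x) absolutely_integrable_on D"
    using DV V(2) rearr_nonneg by (intro integrand_absolutely_integrable[OF V(1) D_sets DK K _ _ fK assms(4)]) auto
  then have k_int: "(\<lambda>x. \<bar>deriv V x\<bar> * k (V x)) absolutely_integrable_on D"
    by (rule iffD1[OF set_integrable_cong[OF refl refl], rotated]) (metis k_eq V(2) DV(3))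
  have inj: "inj_on V D"
  proof (rule inj_onI)
    fix x y assume xy: "x \<in> D" "y \<in> D" "V x = V y"
    then have "rearr x = rearr y" using V(2) DV(3) by metis
    then show "x = y" using reg(2)[OF xy(1)] reg(2)[OF xy(2)] by simp
  qed
  have "(\<integral>\<^sup>+x\<in>?I. ennreal (G \<bar>deriv rearr x\<bar> (rearr x) * f x) \<partial>lebesgue)
      = (\<integral>\<^sup>+x\<in>D. ennreal (\<bar>deriv V x\<bar> * k (V x)) \<partial>lebesgue)"
  proof (rule nn_integral_cong_AE)
    have "AE x in lebesgue. x \<notin> {x. \<not> V differentiable (at x)}"
      using lipschitz_differentiable_ae[OF V(1)] by (intro AE_not_in) (simp add: negligible_iff_null_sets)
    then show "AE x in lebesgue. ennreal (G \<bar>deriv rearr x\<bar> (rearr x) * f x) * indicator ?I x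
        = ennreal (\<bar>deriv V x\<bar> * k (V x)) * indicator D x"
    proof (rule AE_mp, intro AE_I2 impI)
      fix x assume diff: "x \<notin> {x. \<not> V differentiable (at x)}"
      show "ennreal (G \<bar>deriv rearr x\<bar> (rearr x) * f x) * indicator ?I x
        = ennreal (\<bar>deriv V x\<bar> * k (V x)) * indicator D x"
      proof (cases "x \<in> D")
        case True
        then show ?thesis using DV(3) dV k_eq by simp
      next
        case False
        show ?thesis
        proof (cases "x \<in> ?I")
          case True
          then have "deriv rearr x = 0" using False diff by (auto simp: D_def dV)
          then show ?thesis using False assms(5) rearr_nonneg by simp
        qed (use False in simp)
      qed
    qed
  qed
  also have "\<dots> = (\<integral>\<^sup>+c\<in>V ` D. ennreal (k c) \<partial>lebesgue)"
    by (rule nn_integral_injective_substitution(1)[OF D_sets DV(1) inj k_nonneg k_int])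
  also have "\<dots> \<le> (\<integral>\<^sup>+x\<in>E. ennreal (\<bar>deriv U x\<bar> * h x) \<partial>lebesgue)"
  proof (rule coarea_lower_bound[OF cont E_sets EU(1,2) h_nonneg h_int])
    have "AE c in lebesgue. c \<notin> critical_values"
      using negligible_critical_values by (intro AE_not_in) (simp add: negligible_iff_null_sets)
    then show "AE c in lebesgue. \<exists>P. finite P \<and> P \<subseteq> {x \<in> E. U x = c} \<and>
      ennreal (k c) * indicator (V ` D) c \<le> (\<Sum>x\<in>P. ennreal (h x))"
    proof (rule AE_mp, intro AE_I2 impI)
      fix c assume c: "c \<notin> critical_values"
      show "\<exists>P. finite P \<and> P \<subseteq> {x \<in> E. U x = c} \<and>
        ennreal (k c) * indicator (V ` D) c \<le> (\<Sum>x\<in>P. ennreal (h x))"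
      proof (cases "c \<in> V ` D")
        case True
        then obtain x where x: "x \<in> D" "c = rearr x" using V(2) DV(3) by auto
        have c0: "0 < c" and mc: "distribution c = x" using reg[OF x(1)] x(2) by auto
        let ?P = "{p \<in> ?I. U p = c}"
        have fin: "finite ?P" by (rule finite_level_set[OF c0 c])
        have PE: "p \<in> E" if "p \<in> ?P" for p
          using that level_point[OF c0 c, of p] by (auto simp: E_def real_differentiable_def)
        define q where "q = G \<bar>deriv V x\<bar> c / \<bar>deriv V x\<bar>"
        have q0: "0 \<le> q" using assms(3)[of "\<bar>deriv V x\<bar>" c] c0 by (simp add: q_def)
        have q_le: "q * f p \<le> h p" if p: "p \<in> ?P" for p
        proof -
          have Up: "U p = rearr x" using p x(2) by simp
          have "\<bar>deriv V x\<bar> \<le> \<bar>deriv U p\<bar>"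
            using rearr_slope_le[OF _ EU(1,2)[OF PE[OF p]] DV(3)[OF x(1)] reg(2)[OF x(1)] Dw[OF x(1)] Up reg(1)[OF x(1)]] p by simp
          then have "q \<le> G \<bar>deriv U p\<bar> c / \<bar>deriv U p\<bar>"
            unfolding q_def using DV(2)[OF x(1)] EU(2)[OF PE[OF p]] c0
            by (intro mono_onD[OF assms(6)]) auto
          moreover have "0 \<le> f p" using f_pos[of p] p by simp
          moreover have "c = U p" using p by simp
          ultimately show ?thesis
            unfolding h_def by (metis mult_right_mono)
        qed
        \<comment> \<open>The comparison at one level: perimeters first, then slopes.\<close>
        have "k c = q * f x" by (simp add: k_def q_def mc)
        also have "\<dots> \<le> q * (\<Sum>p\<in>?P. f p)"
          using perimeter_bound[OF assms(2) c0 fin] mc DV(3)[OF x(1)] q0 by (intro mult_left_mono) auto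
        also have "\<dots> \<le> (\<Sum>p\<in>?P. h p)"
          unfolding sum_distrib_left by (intro sum_mono q_le)
        finally have "ennreal (k c) \<le> (\<Sum>p\<in>?P. ennreal (h p))"
          using h_nonneg PE by (subst sum_ennreal) (auto intro: ennreal_leI)
        then show ?thesis
          using fin PE True by (intro exI[of _ ?P]) auto
      qed (auto intro: exI[of _ "{}"])
    qed
  qed
  also have "\<dots> \<le> (\<integral>\<^sup>+x\<in>?I. ennreal (G \<bar>deriv u x\<bar> (u x) * f x) \<partial>lebesgue)"
  proof (rule nn_integral_mono)
    fix x
    show "ennreal (\<bar>deriv U x\<bar> * h x) * indicator E x
        \<le> ennreal (G \<bar>deriv u x\<bar> (u x) * f x) * indicator ?I x"
    proof (cases "x \<in> E")
      case True
      then show ?thesis using EU(3)[OF True] by (simp add: h_eq dU U(2))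
    qed simp
  qed
  finally show ?thesis by (simp add: decr_rearr_eq)
qed

end
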